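(* Let $n\ge 3$, and for $\mathbf J=(J_1,\dots,J_n)$ with all $J_i>0$ let $\tau^*(\mathbf J)=\tau_2(\mathbf J)-1$, where $\tau_2(\mathbf J)$ is the relaxation time of the heat-bath Glauber dynamics for the ferromagnetic Ising model on the $n$-cycle with couplings $\mathbf J$. Then $$\tau^*(\mathbf J+t)\ \ge\ \exp(2t)\,\tau^*(\mathbf J)\qquad\text{for all } t\ge 0,$$ where $\mathbf J+t=(J_1+t,\dots,J_n+t)$.
   Context: The cycle has vertices $\{1,\dots,n\}$ and edges $[1,2],[2,3],\dots,[n,1]$; indices are taken mod $n$, so $n+1\equiv 1$. The edge $[i,i+1]$ has coupling $J_i>0$. A configuration is $\sigma\in\{+1,-1\}^n$, and the Gibbs measure (no external field, no boundary conditions) is $\pi(\sigma)=Z^{-1}\exp\big(\sum_{i=1}^n J_i\sigma_i\sigma_{i+1}\big)$, where $Z$ is the normalizing constant. For a vertex $i$, let $\sigma^i$ be the configuration obtained from $\sigma$ by flipping the spin at $i$. The heat-bath Glauber dynamics is the Markov chain on $\{+1,-1\}^n$ with transition matrix $A$ of size $2^n\times 2^n$ given by $A(\sigma,\sigma^i)=\frac1n\,\frac{\pi(\sigma^i)}{\pi(\sigma)+\pi(\sigma^i)}$ for each $i$, $A(\sigma,\sigma)=1-\sum_{i}A(\sigma,\sigma^i)$, and $A(\sigma,\tau)=0$ for all other $\tau$. It is reversible with respect to $\pi$, so its eigenvalues are real; they are listed with multiplicity as $1=\mu_1>\mu_2\ge\dots\ge\mu_{2^n}$. The relaxation time is $\tau_2=\big(n(1-\mu_2)\big)^{-1}$.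 *)

theory Defs
  imports
    "Jordan_Normal_Form.Char_Poly"
    "HOL-Library.FuncSet"
    "HOL-Library.Multiset"
begin

text \<open>
  The vertices of the cycle are the residues \<open>0, \<dots>, n - 1\<close> modulo \<open>n\<close> (the vertex \<open>n\<close> of the
  labelling \<open>1, \<dots>, n\<close> is \<open>0\<close> here); \<open>J i\<close> is the coupling of the edge \<open>[i, i + 1]\<close>. Only the
  values \<open>J 0, \<dots>, J (n - 1)\<close> matter.
\<close>

definition configs :: "nat \<Rightarrow> (nat \<Rightarrow> real) set" where
  "configs n = {..<n} \<rightarrow>\<^sub>E {1, -1}"

definition flip :: "(nat \<Rightarrow> real) \<Rightarrow> nat \<Rightarrow> (nat \<Rightarrow> real)" where
  "flip \<sigma> i = \<sigma>(i := - \<sigma> i)"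

definition weight :: "nat \<Rightarrow> (nat \<Rightarrow> real) \<Rightarrow> (nat \<Rightarrow> real) \<Rightarrow> real" where
  "weight n J \<sigma> = exp (\<Sum>i<n. J i * \<sigma> i * \<sigma> ((i + 1) mod n))"

definition partition_fun :: "nat \<Rightarrow> (nat \<Rightarrow> real) \<Rightarrow> real" where
  "partition_fun n J = (\<Sum>\<sigma>\<in>configs n. weight n J \<sigma>)"

definition gibbs :: "nat \<Rightarrow> (nat \<Rightarrow> real) \<Rightarrow> (nat \<Rightarrow> real) \<Rightarrow> real" where
  "gibbs n J \<sigma> = weight n J \<sigma> / partition_fun n J"

definition move_prob :: "nat \<Rightarrow> (nat \<Rightarrow> real) \<Rightarrow> (nat \<Rightarrow> real) \<Rightarrow> (nat \<Rightarrow> real) \<Rightarrow> real" where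
  "move_prob n J \<sigma> \<tau> = 1 / real n * (gibbs n J \<tau> / (gibbs n J \<sigma> + gibbs n J \<tau>))"

definition glauber :: "nat \<Rightarrow> (nat \<Rightarrow> real) \<Rightarrow> (nat \<Rightarrow> real) \<Rightarrow> (nat \<Rightarrow> real) \<Rightarrow> real" where
  "glauber n J \<sigma> \<tau> =
     (if \<tau> = \<sigma> then 1 - (\<Sum>i<n. move_prob n J \<sigma> (flip \<sigma> i))
      else if \<exists>i<n. \<tau> = flip \<sigma> i then move_prob n J \<sigma> \<tau>
      else 0)"

text \<open>
  The rows and columns of the transition matrix are numbered \<open>0, \<dots>, 2 ^ n - 1\<close> by reading off the
  configuration from the binary digits of the number. The eigenvalues do not depend on the
  numbering.
\<close>

definition config_of :: "nat \<Rightarrow> nat \<Rightarrow> (nat \<Rightarrow> real)" where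
  "config_of n k = (\<lambda>i\<in>{..<n}. if bit k i then 1 else -1)"

lemma bij_betw_config_of: "bij_betw (config_of n) {..<2 ^ n} (configs n)"
proof -
  have inj: "inj_on (config_of n) {..<2 ^ n}"
  proof (rule inj_onI)
    fix k l :: nat
    assume kl: "k \<in> {..<2 ^ n}" "l \<in> {..<2 ^ n}" and eq: "config_of n k = config_of n l"
    have *: "bit k i = bit l i" if "i < n" for i
      using fun_cong[OF eq, of i] that by (auto simp: config_of_def split: if_splits)
    have "take_bit n k = take_bit n l"
      by (rule bit_eqI) (auto simp: bit_take_bit_iff *)
    with kl show "k = l"
      by (simp add: take_bit_nat_eq_self)
  qed
  have sub: "config_of n ` {..<2 ^ n} \<subseteq> configs n"
    by (auto simp: config_of_def configs_def restrict_def PiE_def extensional_def)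
  have "card (configs n) = 2 ^ n"
    by (simp add: configs_def card_PiE numeral_2_eq_2)
  moreover have "finite (configs n)"
    by (auto simp: configs_def intro!: finite_PiE)
  ultimately have "config_of n ` {..<2 ^ n} = configs n"
    using sub inj by (intro card_subset_eq) (simp_all add: card_image)
  with inj show ?thesis
    by (simp add: bij_betw_def)
qed

definition glauber_mat :: "nat \<Rightarrow> (nat \<Rightarrow> real) \<Rightarrow> real mat" where
  "glauber_mat n J = mat (2 ^ n) (2 ^ n) (\<lambda>(k, l). glauber n J (config_of n k) (config_of n l))"

text \<open>
  The real roots of the characteristic polynomial with multiplicity, in decreasing order. By
  reversibility these are all \<open>2 ^ n\<close> eigenvalues. The list is indexed from \<open>0\<close>, so \<open>\<mu>\<^sub>2\<close> is at
  position \<open>1\<close>.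
\<close>

definition glauber_eigenvalues :: "nat \<Rightarrow> (nat \<Rightarrow> real) \<Rightarrow> real list" where
  "glauber_eigenvalues n J = rev (sorted_list_of_multiset (proots (char_poly (glauber_mat n J))))"

definition mu2 :: "nat \<Rightarrow> (nat \<Rightarrow> real) \<Rightarrow> real" where
  "mu2 n J = glauber_eigenvalues n J ! 1"

definition relaxation_time :: "nat \<Rightarrow> (nat \<Rightarrow> real) \<Rightarrow> real" where
  "relaxation_time n J = 1 / (real n * (1 - mu2 n J))"

definition tau_star :: "nat \<Rightarrow> (nat \<Rightarrow> real) \<Rightarrow> real" where
  "tau_star n J = relaxation_time n J - 1"

end

theory Submission
  imports Defs "HOL-Analysis.Function_Topology"
begin

text \<open>
  On a cycle, the conditional mean \<open>tanh (J\<^sub>i\<^sub>-\<^sub>1 \<sigma>\<^sub>i\<^sub>-\<^sub>1 + J\<^sub>i \<sigma>\<^sub>i\<^sub>+\<^sub>1)\<close> of a spin is a linear function of its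
  two neighbours, so the linear functions of the spins are invariant under the dynamics. With
  \<open>s\<^sub>i = sinh 2J\<^sub>i\<close> and \<open>c\<^sub>i = cosh 2J\<^sub>i\<close>, the restriction to them has a positive eigenvector with
  eigenvalue \<open>1 - (1 - \<rho>)/n\<close>, where \<open>\<rho>\<close> is the maximum of \<open>H(v)/D(v)\<close> for \<open>H(v) = \<Sum> 2 s\<^sub>i v\<^sub>i v\<^sub>i\<^sub>+\<^sub>1\<close> and
  \<open>D(v) = \<Sum> c\<^sub>i (v\<^sub>i\<^sup>2 + v\<^sub>i\<^sub>+\<^sub>1\<^sup>2)\<close>. This is a strictly increasing eigenfunction of a chain that preserves
  increasing functions, hence it dominates the discrete gradient of every other eigenfunction, and
  its eigenvalue is \<open>\<mu>\<^sub>2\<close>. Therefore \<open>\<tau>\<^sup>* = \<rho>/(1 - \<rho>)\<close> is the maximum of \<open>H/(D - H)\<close>.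

  The maximizer \<open>v\<close> satisfies \<open>s\<^sub>i (v\<^sub>i\<^sup>2 + v\<^sub>i\<^sub>+\<^sub>1\<^sup>2) \<le> 2 c\<^sub>i v\<^sub>i v\<^sub>i\<^sub>+\<^sub>1\<close> on every edge. Used as a test vector at
  \<open>J + h\<close>, it multiplies \<open>H\<close> by at least \<open>exp 2h\<close> and \<open>D - H\<close> by at most \<open>cosh 2h\<close>, so \<open>\<tau>\<^sup>*\<close> grows by a
  factor of at least \<open>exp 2h / cosh 2h\<close>. For \<open>N\<close> steps \<open>h = t/N\<close> the loss \<open>(cosh (2t/N))\<^sup>N\<close> tends to \<open>1\<close>.
\<close>

subsection \<open>Second eigenvalue of a stochastic matrix\<close>

text \<open>Row sums 1 make the all-ones vector an eigenvector. In the basis formed by the columns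
  of \<open>P\<close>, that vector and all unit vectors but the first, \<open>A\<close> becomes
  block triangular. Its blocks are 1 and the action of \<open>A\<close> on functions modulo
  constants.\<close>

lemma char_poly_deflate_row_sums:
  fixes A :: "'a::field mat"
  assumes A: "A \<in> carrier_mat (Suc m) (Suc m)"
    and rows: "\<And>k. k \<le> m \<Longrightarrow> (\<Sum>l\<le>m. A $$ (k, l)) = 1"
  shows "char_poly A =
    [:-1, 1:] * char_poly (mat m m (\<lambda>(k, l). A $$ (Suc k, Suc l) - A $$ (0, Suc l)))"
proof -
  define B where "B = mat m m (\<lambda>(k, l). A $$ (Suc k, Suc l) - A $$ (0, Suc l))"
  define P :: "'a mat" where "P = mat (Suc m) (Suc m) (\<lambda>(k, l). if k = l \<or> l = 0 then 1 else 0)"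
  define Q :: "'a mat" where
    "Q = mat (Suc m) (Suc m) (\<lambda>(k, l). if k = l then 1 else if l = 0 then -1 else 0)"
  define F where "F = four_block_mat (1\<^sub>m 1) (mat 1 m (\<lambda>(k, l). A $$ (0, Suc l))) (0\<^sub>m m 1) B"
  have dim: "P \<in> carrier_mat (Suc m) (Suc m)" "Q \<in> carrier_mat (Suc m) (Suc m)"
    "B \<in> carrier_mat m m" "F \<in> carrier_mat (Suc m) (Suc m)"
    by (auto simp: P_def Q_def F_def B_def)
  have P_mult: "P * X = mat (Suc m) (Suc m)
      (\<lambda>(k, l). if k = 0 then X $$ (0, l) else X $$ (0, l) + X $$ (k, l))"
    (is "_ = ?R") if X: "X \<in> carrier_mat (Suc m) (Suc m)" for X
  proof (rule eq_matI)
    fix k l assume "k < dim_row ?R" "l < dim_col ?R"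
    then have kl: "k \<le> m" "l \<le> m" by auto
    have "(P * X) $$ (k, l) = (\<Sum>i\<in>{0..<Suc m}. P $$ (k, i) * X $$ (i, l))"
      using X kl by (auto simp: P_def scalar_prod_def)
    also have "\<dots> = X $$ (0, l) + (\<Sum>i\<in>{0..<m}. (if Suc i = k then X $$ (Suc i, l) else 0))"
      unfolding sum.atLeast0_lessThan_Suc_shift using kl
      by (auto simp: P_def intro!: sum.cong)
    also have "(\<Sum>i\<in>{0..<m}. (if Suc i = k then X $$ (Suc i, l) else 0)) = (if k = 0 then 0 else X $$ (k, l))"
      using kl by (cases k) auto
    finally show "(P * X) $$ (k, l) = ?R $$ (k, l)"
      using kl by auto
  qed (use X in \<open>auto simp: P_def\<close>)
  have PQ: "P * Q = 1\<^sub>m (Suc m)"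
    unfolding P_mult[OF dim(2)] by (rule eq_matI) (auto simp: Q_def)
  have QP: "Q * P = 1\<^sub>m (Suc m)"
    by (rule mat_mult_left_right_inverse[OF dim(1,2) PQ])
  have AP: "A * P = P * F"
  proof (rule eq_matI)
    fix k l assume "k < dim_row (P * F)" "l < dim_col (P * F)"
    then have kl: "k \<le> m" "l \<le> m" using dim by auto
    have "(A * P) $$ (k, l) = (\<Sum>i\<le>m. A $$ (k, i) * P $$ (i, l))"
      using A kl by (auto simp: P_def scalar_prod_def atMost_atLeast0 atLeastLessThanSuc_atLeastAtMost)
    also have "\<dots> = (\<Sum>i\<le>m. if l = 0 then A $$ (k, i) else if i = l then A $$ (k, l) else 0)"
      using kl by (intro sum.cong) (auto simp: P_def)
    also have "\<dots> = (if l = 0 then 1 else A $$ (k, l))"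
      using kl rows[of k] by auto
    also have "\<dots> = (P * F) $$ (k, l)"
      using kl unfolding P_mult[OF dim(4)] by (auto simp: F_def B_def)
    finally show "(A * P) $$ (k, l) = (P * F) $$ (k, l)" .
  qed (use A dim in auto)
  have "A = A * (P * Q)" using A PQ by simp
  also have "\<dots> = P * F * Q" using A dim by (simp add: AP[symmetric])
  finally have "similar_mat_wit A F P Q"
    using A dim PQ QP by (auto simp: similar_mat_wit_def Let_def)
  then have "char_poly A = char_poly F"
    by (intro char_poly_similar) (auto simp: similar_mat_def)
  also have "\<dots> = char_poly (1\<^sub>m 1 :: 'a mat) * char_poly B"
    unfolding F_def by (rule char_poly_four_block_zeros_col) (use dim in auto)
  also have "char_poly (1\<^sub>m 1 :: 'a mat) = [:-1, 1:]"
    by (simp add: char_poly_defs det_def)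
  finally show ?thesis by (simp add: B_def)
qed

lemma rev_sorted_list_of_multiset_nth_1:
  fixes M :: "'a::linorder multiset"
  assumes "x \<in># M" and "\<And>y. y \<in># M \<Longrightarrow> y \<le> x" and "x \<le> z"
  shows "rev (sorted_list_of_multiset (add_mset z M)) ! 1 = x"
proof -
  define xs where "xs = sorted_list_of_multiset M"
  have xs: "set xs = set_mset M" "mset xs = M" "sorted xs" by (auto simp: xs_def)
  then have ne: "xs \<noteq> []" using assms(1) by auto
  have "sorted (xs @ [z])"
    using xs assms by (force simp: sorted_append)
  then have "sorted_list_of_multiset (add_mset z M) = xs @ [z]"
    by (metis xs(2) mset_append mset.simps(1,2) sorted_list_of_multiset_mset sorted_sort_id
        add_mset_add_single)
  moreover have "last xs = x"
  proof (rule antisym)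
    show "last xs \<le> x" using assms(2) xs ne by (metis last_in_set)
    obtain ys where "xs = ys @ [last xs]" using ne by (metis append_butlast_last_id)
    then have "\<forall>y\<in>set xs. y \<le> last xs" using xs(3)
      by (metis sorted_append Un_iff list.set_intros(1) set_append empty_set singletonD list.simps(15) order_refl)
    then show "x \<le> last xs" using xs assms(1) by auto
  qed
  ultimately show ?thesis using ne
    by (cases xs rule: rev_cases) auto
qed

text \<open>Splitting off the eigenvalue 1 leaves the quotient by the constants. Its eigenvectors
  lift to solutions of \<open>A g = \<mu> g + c\<close>, whence the affine form of
  \<open>bound\<close>; as \<open>r < 1\<close>, this also excludes a repeated eigenvalue 1.\<close>

lemma second_eigenvalue_stochastic:
  fixes A :: "real mat"
  assumes A: "A \<in> carrier_mat (Suc m) (Suc m)"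
    and rows: "\<And>k. k \<le> m \<Longrightarrow> (\<Sum>l\<le>m. A $$ (k, l)) = 1"
    and "r < 1"
    and f: "\<And>k. k \<le> m \<Longrightarrow> (\<Sum>l\<le>m. A $$ (k, l) * f l) = r * f k" "\<exists>k\<le>m. f k \<noteq> 0"
    and bound: "\<And>\<mu> c g. \<lbrakk>\<And>k. k \<le> m \<Longrightarrow> (\<Sum>l\<le>m. A $$ (k, l) * g l) = \<mu> * g k + c;
          \<exists>k\<le>m. g k \<noteq> g 0\<rbrakk> \<Longrightarrow> \<mu> \<le> r"
  shows "rev (sorted_list_of_multiset (proots (char_poly A))) ! 1 = r"
proof -
  define B where "B = mat m m (\<lambda>(k, l). A $$ (Suc k, Suc l) - A $$ (0, Suc l))"
  have B: "B \<in> carrier_mat m m" by (auto simp: B_def)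
  have cp: "char_poly A = [:-1, 1:] * char_poly B"
    unfolding B_def by (rule char_poly_deflate_row_sums[OF A rows])
  have B0: "char_poly B \<noteq> 0"
    using degree_monic_char_poly[OF B] by auto
  have roots: "\<mu> \<in># proots (char_poly B) \<longleftrightarrow> poly (char_poly B) \<mu> = 0" for \<mu>
    using B0 by simp
  have le: "\<mu> \<le> r" if root: "poly (char_poly B) \<mu> = 0" for \<mu>
  proof -
    obtain w where w: "w \<in> carrier_vec m" "w \<noteq> 0\<^sub>v m" "B *\<^sub>v w = \<mu> \<cdot>\<^sub>v w"
      using root B eigenvalue_root_char_poly[OF B, of \<mu>]
      by (auto simp: eigenvalue_def eigenvector_def)
    \<comment> \<open>The representative of the class of \<open>w\<close> that vanishes at index 0;
      \<open>c\<close> is then the value of \<open>A g\<close> at that index.\<close>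
    define g where "g = (\<lambda>k. if k = 0 then 0 else w $ (k - 1))"
    have split: "(\<Sum>l\<le>m. A $$ (k, l) * g l) = (\<Sum>l<m. A $$ (k, Suc l) * w $ l)" for k
      by (subst sum.atMost_shift) (simp add: g_def)
    define c where "c = (\<Sum>l<m. A $$ (0, Suc l) * w $ l)"
    have "(\<Sum>l\<le>m. A $$ (k, l) * g l) = \<mu> * g k + c" if "k \<le> m" for k
    proof (cases k)
      case 0
      then show ?thesis unfolding split by (simp add: c_def g_def)
    next
      case (Suc j)
      have "(B *\<^sub>v w) $ j = (\<Sum>l<m. (A $$ (Suc j, Suc l) - A $$ (0, Suc l)) * w $ l)"
        using that w(1) Suc by (auto simp: B_def scalar_prod_def lessThan_atLeast0)
      then have "\<mu> * w $ j = (\<Sum>l<m. (A $$ (Suc j, Suc l) - A $$ (0, Suc l)) * w $ l)"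
        using w that Suc by auto
      then show ?thesis unfolding split Suc
        by (simp add: c_def g_def algebra_simps sum_subtractf)
    qed
    moreover have "\<exists>k\<le>m. g k \<noteq> g 0"
    proof -
      obtain j where "j < m" "w $ j \<noteq> 0" using w(1,2) by (metis carrier_vecD eq_vecI index_zero_vec(1,2))
      then show ?thesis by (intro exI[of _ "Suc j"]) (auto simp: g_def)
    qed
    ultimately show "\<mu> \<le> r" by (rule bound)
  qed
  have "eigenvalue A r"
  proof -
    have "eigenvector A (vec (Suc m) f) r"
      unfolding eigenvector_def
    proof (intro conjI)
      show "vec (Suc m) f \<noteq> 0\<^sub>v (dim_row A)"
        using f(2) A by (metis carrier_matD(1) index_vec index_zero_vec(1) le_imp_less_Suc)
      show "A *\<^sub>v vec (Suc m) f = r \<cdot>\<^sub>v vec (Suc m) f"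
      proof (rule eq_vecI)
        fix k assume "k < dim_vec (r \<cdot>\<^sub>v vec (Suc m) f)"
        then have k: "k \<le> m" by auto
        then have "(A *\<^sub>v vec (Suc m) f) $ k = (\<Sum>l\<le>m. A $$ (k, l) * f l)"
          using A by (auto simp: scalar_prod_def atMost_atLeast0 atLeastLessThanSuc_atLeastAtMost)
        then show "(A *\<^sub>v vec (Suc m) f) $ k = (r \<cdot>\<^sub>v vec (Suc m) f) $ k"
          using k f(1) by simp
      qed (use A in auto)
    qed (use A in auto)
    then show ?thesis by (auto simp: eigenvalue_def)
  qed
  \<comment> \<open>\<open>r < 1\<close> is not a root of the factor that was split off.\<close>
  then have "poly (char_poly B) r = 0"
    using \<open>r < 1\<close> unfolding eigenvalue_root_char_poly[OF A] cp by auto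
  moreover have "proots (char_poly A) = add_mset 1 (proots (char_poly B))"
    unfolding cp using B0 by (subst proots_mult) auto
  ultimately show ?thesis
    using le \<open>r < 1\<close> by (simp only:) (rule rev_sorted_list_of_multiset_nth_1; simp only: roots; simp)
qed

subsection \<open>Hyperbolic functions\<close>

text \<open>Sum-to-product formulas: both sums carry the factor
  \<open>2 * cosh (x - y)\<close>.\<close>

lemma tanh_add_mult_cosh:
  "tanh (x + y) * (cosh (2 * x) + cosh (2 * y)) = sinh (2 * x) + sinh (2 * y :: real)"
proof -
  define p where "p = x + y"
  define q where "q = x - y"
  have xy: "2 * x = p + q" "2 * y = p - q" by (auto simp: p_def q_def)
  have "cosh (2 * x) + cosh (2 * y) = 2 * cosh p * cosh q"
    "sinh (2 * x) + sinh (2 * y) = 2 * sinh p * cosh q"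
    unfolding xy by (simp_all add: cosh_add cosh_diff sinh_add sinh_diff)
  then show ?thesis
    using cosh_real_pos[of p] by (simp add: tanh_def p_def[symmetric])
qed

lemma sinh_le_mult_cosh:
  fixes x :: real
  assumes "0 \<le> x"
  shows "sinh x \<le> x * cosh x"
proof -
  have "0 * cosh 0 - sinh 0 \<le> x * cosh x - sinh x"
  proof (rule DERIV_nonneg_imp_nondecreasing[OF assms])
    fix y :: real assume "0 \<le> y"
    then show "\<exists>d. ((\<lambda>x. x * cosh x - sinh x) has_real_derivative d) (at y) \<and> 0 \<le> d"
      by (intro exI[of _ "y * sinh y"]) (auto intro!: derivative_eq_intros)
  qed
  then show ?thesis by simp
qed

text \<open>The derivative of \<open>exp (- (x\<^sup>2 / 2)) * cosh x\<close> has the sign of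
  \<open>sinh x - x * cosh x\<close>. The quadratic exponent makes the accumulated loss of
  \<open>N\<close> steps of size \<open>t/N\<close> disappear in the limit.\<close>

lemma cosh_le_exp_half_square:
  fixes x :: real
  assumes "0 \<le> x"
  shows "cosh x \<le> exp (x\<^sup>2 / 2)"
proof -
  have "exp (- (x\<^sup>2 / 2)) * cosh x \<le> exp (- (0\<^sup>2 / 2)) * cosh 0"
  proof (rule DERIV_nonpos_imp_nonincreasing[OF assms])
    fix y :: real assume "0 \<le> y"
    then have "exp (- (y\<^sup>2 / 2)) * (sinh y - y * cosh y) \<le> 0"
      using sinh_le_mult_cosh[of y] by (simp add: mult_le_0_iff)
    moreover have "((\<lambda>x. exp (- (x\<^sup>2 / 2)) * cosh x) has_real_derivative
        exp (- (y\<^sup>2 / 2)) * (sinh y - y * cosh y)) (at y)"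
      by (auto intro!: derivative_eq_intros simp: algebra_simps)
    ultimately show "\<exists>d. ((\<lambda>x. exp (- (x\<^sup>2 / 2)) * cosh x) has_real_derivative d) (at y) \<and> d \<le> 0"
      by blast
  qed
  then show ?thesis by (simp add: exp_minus field_simps)
qed

subsection \<open>Configurations and transition probabilities\<close>

lemma finite_configs: "finite (configs n)"
  by (auto simp: configs_def intro!: finite_PiE)

lemma configs_spin: "\<sigma> \<in> configs n \<Longrightarrow> i < n \<Longrightarrow> \<sigma> i = 1 \<or> \<sigma> i = -1"
  by (auto simp: configs_def)

lemma configs_fun_upd: "\<sigma> \<in> configs n \<Longrightarrow> i < n \<Longrightarrow> x = 1 \<or> x = -1 \<Longrightarrow> \<sigma>(i := x) \<in> configs n"
  by (auto simp: configs_def PiE_iff extensional_def)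

lemma flip_in_configs: "\<sigma> \<in> configs n \<Longrightarrow> i < n \<Longrightarrow> flip \<sigma> i \<in> configs n"
  using configs_spin[of \<sigma> n i] unfolding flip_def by (intro configs_fun_upd) auto

lemma config_of_in_configs: "k < 2 ^ n \<Longrightarrow> config_of n k \<in> configs n"
  using bij_betwE[OF bij_betw_config_of] by auto

lemma flip_neq: "\<sigma> \<in> configs n \<Longrightarrow> i < n \<Longrightarrow> flip \<sigma> i \<noteq> \<sigma>"
  using configs_spin[of \<sigma> n i] by (auto simp: flip_def fun_eq_iff intro!: exI[of _ i])

lemma flip_inject: "\<sigma> \<in> configs n \<Longrightarrow> i < n \<Longrightarrow> flip \<sigma> i = flip \<sigma> j \<longleftrightarrow> i = j"
  using configs_spin[of \<sigma> n i] by (auto simp: flip_def fun_eq_iff split: if_splits dest: spec[of _ i])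

lemma partition_fun_pos: "partition_fun n J > 0"
  unfolding partition_fun_def
  by (rule sum_pos) (use config_of_in_configs[of 0 n] finite_configs in \<open>auto simp: weight_def\<close>)

lemma move_prob_weight: "move_prob n J \<sigma> \<tau> = weight n J \<tau> / (weight n J \<sigma> + weight n J \<tau>) / n"
  using partition_fun_pos[of n J]
  by (simp add: move_prob_def gibbs_def add_divide_distrib[symmetric])

lemma sum_glauber:
  assumes \<sigma>: "\<sigma> \<in> configs n"
  shows "(\<Sum>\<tau>\<in>configs n. glauber n J \<sigma> \<tau> * g \<tau>) =
    g \<sigma> + (\<Sum>i<n. move_prob n J \<sigma> (flip \<sigma> i) * (g (flip \<sigma> i) - g \<sigma>))"
proof -
  let ?p = "\<lambda>i. move_prob n J \<sigma> (flip \<sigma> i)"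
  \<comment> \<open>The row of \<open>\<sigma>\<close> as a sum of point masses;
    \<open>\<sigma>\<close> and its flips are pairwise distinct, so nothing is counted
    twice.\<close>
  have "glauber n J \<sigma> \<tau> * g \<tau> = (if \<tau> = \<sigma> then (1 - (\<Sum>i<n. ?p i)) * g \<sigma> else 0) +
    (\<Sum>i<n. if \<tau> = flip \<sigma> i then ?p i * g (flip \<sigma> i) else 0)" for \<tau>
  proof (cases "\<exists>i<n. \<tau> = flip \<sigma> i")
    case True
    then obtain j where j: "j < n" "\<tau> = flip \<sigma> j" by blast
    have "(\<Sum>i<n. if \<tau> = flip \<sigma> i then ?p i * g (flip \<sigma> i) else 0) =
      (\<Sum>i<n. if i = j then ?p j * g (flip \<sigma> j) else 0)"
      using j flip_inject[OF \<sigma> j(1)] by (intro sum.cong) auto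
    then show ?thesis using j flip_neq[OF \<sigma> j(1)] by (auto simp: glauber_def)
  next
    case False
    then have "(\<Sum>i<n. if \<tau> = flip \<sigma> i then ?p i * g (flip \<sigma> i) else 0) = 0"
      by (intro sum.neutral) auto
    then show ?thesis using False by (auto simp: glauber_def)
  qed
  then have "(\<Sum>\<tau>\<in>configs n. glauber n J \<sigma> \<tau> * g \<tau>) =
    (\<Sum>\<tau>\<in>configs n. if \<tau> = \<sigma> then (1 - (\<Sum>i<n. ?p i)) * g \<sigma> else 0) +
    (\<Sum>i<n. \<Sum>\<tau>\<in>configs n. if \<tau> = flip \<sigma> i then ?p i * g (flip \<sigma> i) else 0)"
    by (simp only: sum.distrib) (subst sum.swap, rule refl)
  also have "\<dots> = (1 - (\<Sum>i<n. ?p i)) * g \<sigma> + (\<Sum>i<n. ?p i * g (flip \<sigma> i))"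
    using \<sigma> flip_in_configs[OF \<sigma>] by (simp add: finite_configs)
  also have "\<dots> = g \<sigma> + (\<Sum>i<n. ?p i * (g (flip \<sigma> i) - g \<sigma>))"
    by (simp add: algebra_simps sum_subtractf sum_distrib_left)
  finally show ?thesis .
qed

lemma constant_on_configs:
  assumes "\<And>\<sigma> i. \<sigma> \<in> configs n \<Longrightarrow> i < n \<Longrightarrow> g (\<sigma>(i := 1)) = g (\<sigma>(i := -1))"
    and \<sigma>: "\<sigma> \<in> configs n" and \<tau>: "\<tau> \<in> configs n"
  shows "g \<sigma> = g \<tau>"
proof -
  \<comment> \<open>A path from \<open>\<tau>\<close> to \<open>\<sigma>\<close> that changes at
    most one spin per step.\<close>
  define h where "h k = (\<lambda>i. if i < k then \<sigma> i else \<tau> i)" for k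
  have h: "h k \<in> configs n" for k
    using \<sigma> \<tau> by (auto simp: h_def configs_def PiE_iff extensional_def)
  have "g (h k) = g \<tau>" if "k \<le> n" for k
    using that
  proof (induction k)
    case (Suc k)
    have "h (Suc k) = (h k)(k := \<sigma> k)" "h k = (h k)(k := \<tau> k)"
      by (auto simp: h_def fun_eq_iff less_Suc_eq)
    moreover have "g ((h k)(k := \<sigma> k)) = g ((h k)(k := \<tau> k))"
      using configs_spin[OF \<sigma>, of k] configs_spin[OF \<tau>, of k] assms(1)[OF h, of k k] Suc.prems by auto
    ultimately have "g (h (Suc k)) = g (h k)" by metis
    then show ?case using Suc by simp
  qed (simp add: h_def)
  moreover have "h n = \<sigma>"
    using \<sigma> \<tau> by (auto simp: h_def configs_def PiE_iff extensional_def fun_eq_iff)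
  ultimately show ?thesis by fastforce
qed

definition spin_increasing :: "nat \<Rightarrow> ((nat \<Rightarrow> real) \<Rightarrow> real) \<Rightarrow> bool" where
  "spin_increasing n g \<longleftrightarrow> (\<forall>\<sigma>\<in>configs n. \<forall>i<n. g (\<sigma>(i := -1)) \<le> g (\<sigma>(i := 1)))"

subsection \<open>Heat bath on the cycle\<close>

locale cycle =
  fixes n :: nat
  assumes n_ge_3: "3 \<le> n"
begin

section \<open>Indices modulo \<open>n\<close>\<close>

definition nxt :: "nat \<Rightarrow> nat" where
  "nxt i = (i + 1) mod n"

definition prv :: "nat \<Rightarrow> nat" where
  "prv i = (i + n - 1) mod n"

lemma nxt_less [simp]: "nxt i < n" and prv_less [simp]: "prv i < n"
  using n_ge_3 by (auto simp: nxt_def prv_def)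

lemma nxt_eq: "i < n \<Longrightarrow> nxt i = (if Suc i = n then 0 else Suc i)"
  by (auto simp: nxt_def)

lemma prv_eq: "i < n \<Longrightarrow> prv i = (if i = 0 then n - 1 else i - 1)"
  using n_ge_3 by (cases i) (auto simp: prv_def)

lemma nxt_prv [simp]: "i < n \<Longrightarrow> nxt (prv i) = i"
  by (cases "i = 0") (auto simp: prv_eq nxt_def)

lemma prv_nxt [simp]: "i < n \<Longrightarrow> prv (nxt i) = i"
  by (cases "Suc i = n") (auto simp: nxt_eq prv_def)

lemma nxt_neq: "i < n \<Longrightarrow> nxt i \<noteq> i" "i < n \<Longrightarrow> nxt (nxt i) \<noteq> i"
  using n_ge_3 by (auto simp: nxt_eq)

lemma nxt_inject: "i < n \<Longrightarrow> j < n \<Longrightarrow> nxt i = nxt j \<longleftrightarrow> i = j"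
  by (metis prv_nxt)

lemma vertices_nonempty: "{..<n} \<noteq> {}"
  using n_ge_3 by (auto simp: lessThan_empty_iff)

lemma sum_nxt: "(\<Sum>i<n. F (nxt i)) = (\<Sum>i<n. F i)"
  by (rule sum.reindex_bij_witness[of _ prv nxt]) auto

text \<open>The edges at vertex \<open>nxt j\<close> are \<open>j\<close> and \<open>nxt j\<close>.
  The lemma is applied to differences caused by changing that one vertex.\<close>

lemma sum_incident_edges:
  fixes F :: "nat \<Rightarrow> 'a::comm_monoid_add"
  assumes "j < n" and "\<And>i. \<lbrakk>i < n; i \<noteq> j; i \<noteq> nxt j\<rbrakk> \<Longrightarrow> F i = 0"
  shows "(\<Sum>i<n. F i) = F j + F (nxt j)"
proof -
  have "(\<Sum>i<n. F i) = (\<Sum>i\<in>{j, nxt j}. F i)"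
    by (rule sum.mono_neutral_right) (use assms in auto)
  then show ?thesis using nxt_neq(1)[OF assms(1)] by auto
qed

lemma propagate_backwards:
  assumes "j < n" "P j" and step: "\<And>i. i < n \<Longrightarrow> P (nxt i) \<Longrightarrow> P i" and "k < n"
  shows "P k"
proof -
  have down: "P k" if "k \<le> j" "j < n" "P j" for k j
    using that
  proof (induction k rule: inc_induct)
    case (step k)
    then show ?case using assms(3)[of k] by (auto simp: nxt_eq)
  qed
  \<comment> \<open>Descend to 0 and wrap around to the top vertex; from there a second descent
    reaches every \<open>k\<close>.\<close>
  have "P (n - 1)"
    using down[OF _ assms(1,2), of 0] step[of "n - 1"] n_ge_3 by (auto simp: nxt_eq)
  then show ?thesis using down[of k "n - 1"] assms(4) by auto
qed

section \<open>The heat-bath operator and its monotonicity\<close>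

definition local_field :: "(nat \<Rightarrow> real) \<Rightarrow> (nat \<Rightarrow> real) \<Rightarrow> nat \<Rightarrow> real" where
  "local_field J \<sigma> i = J (prv i) * \<sigma> (prv i) + J i * \<sigma> (nxt i)"

text \<open>The kernel acting on functions: a uniformly chosen spin is redrawn from its conditional
  distribution, whose mean is \<open>tanh (local_field J \<sigma> i)\<close>.\<close>

definition heat_bath :: "(nat \<Rightarrow> real) \<Rightarrow> ((nat \<Rightarrow> real) \<Rightarrow> real) \<Rightarrow> (nat \<Rightarrow> real) \<Rightarrow> real" where
  "heat_bath J g \<sigma> = (\<Sum>i<n. (1 + tanh (local_field J \<sigma> i)) / 2 * g (\<sigma>(i := 1)) +
     (1 - tanh (local_field J \<sigma> i)) / 2 * g (\<sigma>(i := -1))) / n"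

lemma weight_flip:
  assumes "i < n"
  shows "weight n J (flip \<sigma> i) = weight n J \<sigma> * exp (- 2 * (\<sigma> i * local_field J \<sigma> i))"
proof -
  let ?F = "\<lambda>\<sigma> j. J j * \<sigma> j * \<sigma> (nxt j)"
  have neq: "prv i \<noteq> i" "nxt i \<noteq> i"
    using assms nxt_neq(1)[of "prv i"] nxt_neq(1)[of i] by auto
  have "(\<Sum>j<n. ?F (flip \<sigma> i) j - ?F \<sigma> j) = - 2 * (\<sigma> i * local_field J \<sigma> i)"
    using assms neq
    by (subst sum_incident_edges[of "prv i"])
      (auto simp: flip_def local_field_def algebra_simps dest: prv_nxt)
  then have "(\<Sum>j<n. ?F (flip \<sigma> i) j) = (\<Sum>j<n. ?F \<sigma> j) + - 2 * (\<sigma> i * local_field J \<sigma> i)"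
    by (simp add: sum_subtractf)
  then show ?thesis
    unfolding weight_def nxt_def[symmetric] by (simp only: exp_add)
qed

lemma move_prob_flip:
  assumes \<sigma>: "\<sigma> \<in> configs n" and i: "i < n"
  shows "move_prob n J \<sigma> (flip \<sigma> i) = (1 - \<sigma> i * tanh (local_field J \<sigma> i)) / 2 / n"
proof -
  define y where "y = \<sigma> i * local_field J \<sigma> i"
  have w: "weight n J \<sigma> > 0" by (simp add: weight_def)
  have "weight n J (flip \<sigma> i) / (weight n J \<sigma> + weight n J (flip \<sigma> i)) =
    (weight n J \<sigma> * exp (- 2 * y)) / (weight n J \<sigma> * (1 + exp (- 2 * y)))"
    unfolding weight_flip[OF i] by (simp add: y_def algebra_simps)
  also have "\<dots> = exp (- 2 * y) / (1 + exp (- 2 * y))"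
    using w by simp
  also have "\<dots> = (1 - tanh y) / 2"
    using exp_gt_zero[of "- 2 * y"] by (simp add: tanh_real_altdef divide_simps add_pos_pos less_imp_neq[THEN not_sym])
  also have "tanh y = \<sigma> i * tanh (local_field J \<sigma> i)"
    using configs_spin[OF \<sigma> i] by (auto simp: y_def)
  finally show ?thesis by (simp only: move_prob_weight)
qed

lemma sum_glauber_heat_bath:
  assumes \<sigma>: "\<sigma> \<in> configs n"
  shows "(\<Sum>\<tau>\<in>configs n. glauber n J \<sigma> \<tau> * g \<tau>) = heat_bath J g \<sigma>"
proof -
  have "g \<sigma> + (\<Sum>i<n. move_prob n J \<sigma> (flip \<sigma> i) * (g (flip \<sigma> i) - g \<sigma>)) =
    (\<Sum>i<n. g \<sigma> / n + move_prob n J \<sigma> (flip \<sigma> i) * (g (flip \<sigma> i) - g \<sigma>))"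
    using n_ge_3 by (simp add: sum.distrib)
  also have "\<dots> = (\<Sum>i<n. ((1 + tanh (local_field J \<sigma> i)) / 2 * g (\<sigma>(i := 1)) +
     (1 - tanh (local_field J \<sigma> i)) / 2 * g (\<sigma>(i := -1))) / n)"
  proof (rule sum.cong)
    fix i assume "i \<in> {..<n}"
    then have i: "i < n" by simp
    define T where "T = tanh (local_field J \<sigma> i)"
    \<comment> \<open>Flipping or keeping the spin at \<open>i\<close> is the same as redrawing it,
      since the present value is one of the two possible ones.\<close>
    have *: "g \<sigma> + (1 - \<sigma> i * T) / 2 * (g (flip \<sigma> i) - g \<sigma>) =
      (1 + T) / 2 * g (\<sigma>(i := 1)) + (1 - T) / 2 * g (\<sigma>(i := -1))"
      using configs_spin[OF \<sigma> i]
    proof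
      assume "\<sigma> i = 1"
      moreover from this have "\<sigma>(i := 1) = \<sigma>" by auto
      ultimately show ?thesis by (simp add: flip_def field_simps)
    next
      assume "\<sigma> i = -1"
      moreover from this have "\<sigma>(i := -1) = \<sigma>" by auto
      ultimately show ?thesis by (simp add: flip_def field_simps)
    qed
    show "g \<sigma> / n + move_prob n J \<sigma> (flip \<sigma> i) * (g (flip \<sigma> i) - g \<sigma>) =
      ((1 + tanh (local_field J \<sigma> i)) / 2 * g (\<sigma>(i := 1)) +
       (1 - tanh (local_field J \<sigma> i)) / 2 * g (\<sigma>(i := -1))) / n"
      unfolding move_prob_flip[OF \<sigma> i] T_def[symmetric] *[symmetric]
      by (simp add: add_divide_distrib)
  qed simp
  finally show ?thesis
    unfolding sum_glauber[OF \<sigma>] heat_bath_def by (simp add: sum_divide_distrib)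
qed

lemma heat_bath_linear:
  "heat_bath J (\<lambda>\<sigma>. a * f \<sigma> + b * g \<sigma>) \<sigma> = a * heat_bath J f \<sigma> + b * heat_bath J g \<sigma>"
  unfolding heat_bath_def times_divide_eq_right add_divide_distrib[symmetric] sum_distrib_left
    sum.distrib[symmetric]
  by (rule arg_cong[where f = "\<lambda>x. x / _"], rule sum.cong) (auto simp: field_simps)

lemma heat_bath_const: "heat_bath J (\<lambda>_. a) \<sigma> = a"
  using n_ge_3 by (simp add: heat_bath_def field_simps)

text \<open>Attractiveness of the ferromagnet: raising the spin at \<open>j\<close> raises every
  local field, hence the probability of each redrawn spin being +1.\<close>

lemma spin_increasing_heat_bath:
  assumes J: "\<And>i. i < n \<Longrightarrow> J i \<ge> 0" and g: "spin_increasing n g"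
  shows "spin_increasing n (heat_bath J g)"
  unfolding spin_increasing_def
proof (intro ballI allI impI)
  fix \<sigma> j assume \<sigma>: "\<sigma> \<in> configs n" and j: "j < n"
  define upd where "upd \<tau> i = (1 + tanh (local_field J \<tau> i)) / 2 * g (\<tau>(i := 1)) +
     (1 - tanh (local_field J \<tau> i)) / 2 * g (\<tau>(i := -1))" for \<tau> i
  have "upd (\<sigma>(j := -1)) i \<le> upd (\<sigma>(j := 1)) i" if i: "i < n" for i
  proof (cases "i = j")
    case True
    \<comment> \<open>The field at \<open>j\<close> does not involve the spin at \<open>j\<close>,
      and redrawing that spin erases the difference.\<close>
    have "prv j \<noteq> j" "nxt j \<noteq> j" using j nxt_neq(1)[of "prv j"] nxt_neq(1)[of j] by auto
    then show ?thesis using True by (simp add: upd_def local_field_def)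
  next
    case False
    define T where "T = tanh (local_field J (\<sigma>(j := -1)) i)"
    define T' where "T' = tanh (local_field J (\<sigma>(j := 1)) i)"
    have "local_field J (\<sigma>(j := -1)) i \<le> local_field J (\<sigma>(j := 1)) i"
      unfolding local_field_def using J[of "prv i"] J[OF i]
      by (intro add_mono mult_left_mono) auto
    then have T: "T \<le> T'" "T < 1" "-1 < T"
      by (auto simp: T_def T'_def tanh_real_lt_1 tanh_real_gt_neg1)
    have swap: "\<sigma>(j := a, i := b) = \<sigma>(i := b, j := a)" for a b
      using False by (rule fun_upd_twist[symmetric])
    have conf: "\<sigma>(i := a) \<in> configs n" "\<sigma>(j := a) \<in> configs n" if "a = 1 \<or> a = -1" for a
      using \<sigma> i j that configs_fun_upd by blast+
    have plus: "g (\<sigma>(j := -1, i := 1)) \<le> g (\<sigma>(j := 1, i := 1))"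
      and minus: "g (\<sigma>(j := -1, i := -1)) \<le> g (\<sigma>(j := 1, i := -1))"
      using g conf(1) j unfolding swap spin_increasing_def by blast+
    have top: "g (\<sigma>(j := 1, i := -1)) \<le> g (\<sigma>(j := 1, i := 1))"
      using g conf(2) i unfolding spin_increasing_def by blast
    \<comment> \<open>First raise the spin at \<open>j\<close> with the probabilities fixed, then
      move probability from -1 to +1 at \<open>i\<close>.\<close>
    have "upd (\<sigma>(j := -1)) i \<le> (1 + T) / 2 * g (\<sigma>(j := 1, i := 1)) + (1 - T) / 2 * g (\<sigma>(j := 1, i := -1))"
      unfolding upd_def T_def[symmetric]
      using T plus minus by (intro add_mono mult_left_mono) auto
    also have "\<dots> \<le> (1 + T') / 2 * g (\<sigma>(j := 1, i := 1)) + (1 - T') / 2 * g (\<sigma>(j := 1, i := -1))"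
      using mult_right_mono[OF T(1), of "g (\<sigma>(j := 1, i := 1)) - g (\<sigma>(j := 1, i := -1))"] top
      by (simp add: field_simps)
    also have "\<dots> = upd (\<sigma>(j := 1)) i" by (simp add: upd_def T'_def)
    finally show ?thesis .
  qed
  then show "heat_bath J g (\<sigma>(j := -1)) \<le> heat_bath J g (\<sigma>(j := 1))"
    unfolding heat_bath_def upd_def[symmetric]
    by (intro divide_right_mono sum_mono) auto
qed

text \<open>Let \<open>C\<close> be the largest ratio of the gradients of \<open>g\<close> and
  \<open>f\<close>. Then \<open>C f + g\<close> and \<open>C f - g\<close> are increasing and remain
  so under the heat bath. Where the ratio is attained, this bounds \<open>\<mu>\<close> by
  \<open>r\<close>; the constant \<open>c\<close> cancels in gradients.\<close>

lemma eigenvalue_le_of_increasing_eigenfunction: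
  assumes J: "\<And>i. i < n \<Longrightarrow> J i \<ge> 0"
    and f: "\<And>\<sigma>. \<sigma> \<in> configs n \<Longrightarrow> heat_bath J f \<sigma> = r * f \<sigma>"
    and f_incr: "\<And>\<sigma> i. \<sigma> \<in> configs n \<Longrightarrow> i < n \<Longrightarrow> f (\<sigma>(i := -1)) < f (\<sigma>(i := 1))"
    and g: "\<And>\<sigma>. \<sigma> \<in> configs n \<Longrightarrow> heat_bath J g \<sigma> = \<mu> * g \<sigma> + c"
    and g_nonconst: "\<sigma>\<^sub>1 \<in> configs n" "\<sigma>\<^sub>2 \<in> configs n" "g \<sigma>\<^sub>1 \<noteq> g \<sigma>\<^sub>2"
  shows "\<mu> \<le> r"
proof -
  define df where "df = (\<lambda>(\<sigma>, i). f (\<sigma>(i := 1)) - f (\<sigma>(i := -1)))"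
  define dg where "dg = (\<lambda>(\<sigma>, i). g (\<sigma>(i := 1)) - g (\<sigma>(i := -1)))"
  define S where "S = configs n \<times> {..<n}"
  have df: "df x > 0" if "x \<in> S" for x
    using that f_incr by (auto simp: S_def df_def)
  have fin: "finite S" by (simp add: S_def finite_configs)
  have "S \<noteq> {}" using g_nonconst(1) vertices_nonempty by (auto simp: S_def)
  define C where "C = Max ((\<lambda>x. \<bar>dg x\<bar> / df x) ` S)"
  have "C \<in> (\<lambda>x. \<bar>dg x\<bar> / df x) ` S"
    unfolding C_def using fin \<open>S \<noteq> {}\<close> by (intro Max_in) auto
  then obtain y where y: "y \<in> S" "C = \<bar>dg y\<bar> / df y" by blast
  have le: "\<bar>dg x\<bar> \<le> C * df x" if "x \<in> S" for x
  proof -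
    have "\<bar>dg x\<bar> / df x \<le> C" unfolding C_def using fin that by (intro Max_ge) auto
    then show ?thesis using df[OF that] by (simp add: field_simps)
  qed
  \<comment> \<open>Otherwise every discrete gradient of \<open>g\<close> vanishes and
    \<open>g\<close> is constant.\<close>
  have "C > 0"
  proof (rule ccontr)
    assume "\<not> C > 0"
    then have "dg x = 0" if "x \<in> S" for x
      using le[OF that] df[OF that] mult_nonpos_nonneg[of C "df x"] by simp
    then have "g (\<sigma>(i := 1)) = g (\<sigma>(i := -1))" if "\<sigma> \<in> configs n" "i < n" for \<sigma> i
      using that by (force simp: S_def dg_def)
    then show False using constant_on_configs[of n g] g_nonconst by blast
  qed
  have "e * \<mu> * dg y + C * r * df y \<ge> 0" if e: "e = 1 \<or> e = -1" for e
  proof -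
    have "spin_increasing n (\<lambda>\<sigma>. C * f \<sigma> + e * g \<sigma>)"
      unfolding spin_increasing_def
    proof (intro ballI allI impI)
      fix \<sigma> i assume "\<sigma> \<in> configs n" "i < n"
      then have "\<bar>dg (\<sigma>, i)\<bar> \<le> C * df (\<sigma>, i)" by (intro le) (auto simp: S_def)
      then have "0 \<le> C * df (\<sigma>, i) + e * dg (\<sigma>, i)" using e by auto
      then show "C * f (\<sigma>(i := -1)) + e * g (\<sigma>(i := -1)) \<le> C * f (\<sigma>(i := 1)) + e * g (\<sigma>(i := 1))"
        by (simp add: df_def dg_def algebra_simps)
    qed
    from spin_increasing_heat_bath[OF _ this] J
    have incr: "spin_increasing n (heat_bath J (\<lambda>\<sigma>. C * f \<sigma> + e * g \<sigma>))"
      by blast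
    obtain \<sigma> i where \<sigma>: "y = (\<sigma>, i)" "\<sigma> \<in> configs n" "i < n" using y by (auto simp: S_def)
    then have "\<sigma>(i := 1) \<in> configs n" "\<sigma>(i := -1) \<in> configs n" using configs_fun_upd by blast+
    moreover have "heat_bath J (\<lambda>\<sigma>. C * f \<sigma> + e * g \<sigma>) (\<sigma>(i := -1))
      \<le> heat_bath J (\<lambda>\<sigma>. C * f \<sigma> + e * g \<sigma>) (\<sigma>(i := 1))"
      using incr \<sigma> by (auto simp: spin_increasing_def)
    ultimately show ?thesis
      unfolding heat_bath_linear \<sigma>(1) by (simp add: f g df_def dg_def algebra_simps)
  qed
  from this[of 1] this[of "-1"] have "\<bar>\<mu> * dg y\<bar> \<le> C * r * df y" by auto
  then have "\<bar>\<mu>\<bar> * \<bar>dg y\<bar> \<le> C * r * df y" by (simp add: abs_mult)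
  moreover have "\<bar>dg y\<bar> = C * df y" using y df[OF y(1)] by simp
  ultimately have "\<bar>\<mu>\<bar> * (C * df y) \<le> r * (C * df y)" by (simp add: mult_ac)
  then show ?thesis using df[OF y(1)] \<open>C > 0\<close> by simp
qed

subsection \<open>The Perron vector\<close>

definition hopping :: "(nat \<Rightarrow> real) \<Rightarrow> (nat \<Rightarrow> real) \<Rightarrow> real" where
  "hopping J v = (\<Sum>i<n. 2 * sinh (2 * J i) * v i * v (nxt i))"

definition onsite :: "(nat \<Rightarrow> real) \<Rightarrow> (nat \<Rightarrow> real) \<Rightarrow> real" where
  "onsite J v = (\<Sum>i<n. cosh (2 * J i) * ((v i)\<^sup>2 + (v (nxt i))\<^sup>2))"

text \<open>The stationarity equations of the quotient of \<open>hopping\<close> and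
  \<open>onsite\<close>, with a positive solution. The equation for vertex \<open>nxt i\<close> is
  indexed by \<open>i\<close>, which avoids \<open>prv\<close>.\<close>

definition perron_pair :: "(nat \<Rightarrow> real) \<Rightarrow> real \<Rightarrow> (nat \<Rightarrow> real) \<Rightarrow> bool" where
  "perron_pair J \<rho> v \<longleftrightarrow> (\<forall>i<n. v i > 0) \<and>
     (\<forall>i<n. sinh (2 * J i) * v i + sinh (2 * J (nxt i)) * v (nxt (nxt i)) =
            \<rho> * (cosh (2 * J i) + cosh (2 * J (nxt i))) * v (nxt i))"

text \<open>In a single coordinate \<open>hopping\<close> is affine, as no edge is a loop, and
  \<open>onsite\<close> is quadratic. These exact expansions serve as the first variation at a
  maximizer.\<close>

lemma hopping_update:
  assumes "j < n"
  shows "hopping J (v(nxt j := v (nxt j) + x)) =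
    hopping J v + 2 * x * (sinh (2 * J j) * v j + sinh (2 * J (nxt j)) * v (nxt (nxt j)))"
proof -
  let ?w = "v(nxt j := v (nxt j) + x)"
  have "hopping J ?w - hopping J v =
    (\<Sum>i<n. 2 * sinh (2 * J i) * (?w i * ?w (nxt i) - v i * v (nxt i)))"
    unfolding hopping_def sum_subtractf[symmetric] by (rule sum.cong) (auto simp: algebra_simps)
  also have "\<dots> = 2 * x * (sinh (2 * J j) * v j + sinh (2 * J (nxt j)) * v (nxt (nxt j)))"
    by (subst sum_incident_edges[OF assms])
      (use assms nxt_neq[of j] nxt_neq[of "nxt j"] in \<open>auto simp: nxt_inject algebra_simps\<close>)
  finally show ?thesis by simp
qed

lemma onsite_update:
  assumes "j < n"
  shows "onsite J (v(nxt j := v (nxt j) + x)) =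
    onsite J v + (cosh (2 * J j) + cosh (2 * J (nxt j))) * (2 * x * v (nxt j) + x\<^sup>2)"
proof -
  let ?w = "v(nxt j := v (nxt j) + x)"
  have "onsite J ?w - onsite J v =
    (\<Sum>i<n. cosh (2 * J i) * ((?w i)\<^sup>2 - (v i)\<^sup>2 + ((?w (nxt i))\<^sup>2 - (v (nxt i))\<^sup>2)))"
    unfolding onsite_def sum_subtractf[symmetric] by (rule sum.cong) (auto simp: algebra_simps)
  also have "\<dots> = (cosh (2 * J j) + cosh (2 * J (nxt j))) * (2 * x * v (nxt j) + x\<^sup>2)"
    by (subst sum_incident_edges[OF assms])
      (use assms nxt_neq[of j] nxt_neq[of "nxt j"] in
        \<open>auto simp: nxt_inject algebra_simps power2_eq_square\<close>)
  finally show ?thesis by simp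
qed

text \<open>\<open>hopping\<close> is maximized over nonnegative vectors with \<open>onsite\<close>
  equal to 1. Absolute values keep \<open>onsite\<close> and do not lower \<open>hopping\<close>, so
  the maximum bounds the quotient on all vectors.\<close>

lemma perron_pair_exists:
  assumes J: "\<And>i. i < n \<Longrightarrow> J i > 0"
  obtains \<rho> v where "perron_pair J \<rho> v" "\<And>w. hopping J w \<le> \<rho> * onsite J w"
proof -
  have cont: "continuous_on X (\<lambda>v::nat \<Rightarrow> real. v i)" for X i
    by (rule continuous_on_subset[OF continuous_on_product_coordinates]) simp
  \<comment> \<open>Coordinates that are not vertices are fixed at 0, so that this subset of the
    function space is compact by Tychonoff.\<close>
  define box where "box = (Pi\<^sub>E UNIV (\<lambda>i. if i < n then {0..1} else {0}) :: (nat \<Rightarrow> real) set)"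
  define K where "K = box \<inter> {v. onsite J v = 1}"
  have "compactin (product_topology (\<lambda>_. euclidean) UNIV) box"
    unfolding box_def compactin_PiE by auto
  then have "compact box" by (simp add: euclidean_product_topology)
  moreover have "closed {v. onsite J v = 1}"
    unfolding onsite_def by (intro closed_Collect_eq continuous_intros cont)
  ultimately have "compact K" unfolding K_def by blast
  have cosh_pos: "0 < cosh (x::real)" for x by (rule cosh_real_pos)
  \<comment> \<open>As \<open>cosh\<close> is at least 1, the normalization
    \<open>onsite J v = 1\<close> already confines the coordinates to the unit box.\<close>
  have site: "(v i)\<^sup>2 \<le> onsite J v" if "i < n" for v i
  proof -
    have "(v i)\<^sup>2 \<le> cosh (2 * J i) * ((v i)\<^sup>2 + (v (nxt i))\<^sup>2)"
      using mult_mono[OF cosh_real_ge_1[of "2 * J i"], of "(v i)\<^sup>2" "(v i)\<^sup>2 + (v (nxt i))\<^sup>2"] by simp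
    also have "\<dots> \<le> onsite J v"
      unfolding onsite_def by (rule member_le_sum) (use that less_imp_le[OF cosh_pos] in auto)
    finally show ?thesis .
  qed
  define normed where
    "normed w = (\<lambda>i. if i < n then \<bar>w i\<bar> / sqrt (onsite J w) else 0)" for w
  have normed: "normed w \<in> K" "hopping J w \<le> onsite J w * hopping J (normed w)"
    if pos: "onsite J w > 0" for w
  proof -
    have "onsite J (normed w) = (\<Sum>i<n. cosh (2 * J i) * ((w i)\<^sup>2 + (w (nxt i))\<^sup>2) / onsite J w)"
      unfolding onsite_def[of J "normed w"]
      by (rule sum.cong) (use pos in \<open>auto simp: normed_def power_divide add_divide_distrib[symmetric]\<close>)
    also have "\<dots> = 1"
      using pos by (simp add: sum_divide_distrib[symmetric] onsite_def[symmetric])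
    finally have 1: "onsite J (normed w) = 1" .
    moreover have "normed w i \<le> 1" if "i < n" for i
      using site[OF that, of "normed w"] unfolding 1 by (simp add: abs_square_le_1)
    ultimately show "normed w \<in> K"
      using pos by (auto simp: K_def box_def normed_def PiE_def)
    have "hopping J w \<le> (\<Sum>i<n. 2 * sinh (2 * J i) * \<bar>w i\<bar> * \<bar>w (nxt i)\<bar>)"
      unfolding hopping_def
    proof (rule sum_mono)
      fix i assume "i \<in> {..<n}"
      then have "sinh (2 * J i) > 0" using J by simp
      then show "2 * sinh (2 * J i) * w i * w (nxt i) \<le> 2 * sinh (2 * J i) * \<bar>w i\<bar> * \<bar>w (nxt i)\<bar>"
        using abs_ge_self[of "w i * w (nxt i)"] by (simp add: abs_mult mult.assoc)
    qed
    also have "\<dots> = onsite J w * hopping J (normed w)"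
      unfolding hopping_def[of J "normed w"] sum_distrib_left
      by (rule sum.cong) (use pos in \<open>auto simp: normed_def field_simps\<close>)
    finally show "hopping J w \<le> onsite J w * hopping J (normed w)" .
  qed
  have "onsite J (\<lambda>_. 1) > 0"
    using site[of 0 "\<lambda>_. 1"] n_ge_3 by simp
  then have "K \<noteq> {}" using normed(1) by blast
  moreover have "continuous_on K (hopping J)"
    unfolding hopping_def by (intro continuous_intros cont)
  ultimately obtain v where v: "v \<in> K" "\<And>w. w \<in> K \<Longrightarrow> hopping J w \<le> hopping J v"
    using continuous_attains_sup[OF \<open>compact K\<close>] by blast
  define \<rho> where "\<rho> = hopping J v"
  have v1: "onsite J v = 1" and v0: "\<And>i. v i \<ge> 0"
    using v(1) by (auto simp: K_def box_def PiE_iff split: if_splits)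
  have le: "hopping J w \<le> \<rho> * onsite J w" for w
  proof (cases "onsite J w > 0")
    case True
    have "onsite J w * hopping J (normed w) \<le> onsite J w * \<rho>"
      using True v(2)[OF normed(1)[OF True]] by (simp add: \<rho>_def)
    then show ?thesis using normed(2)[OF True] by (simp add: mult.commute)
  next
    case False
    then have "w i = 0" if "i < n" for i
      using site[OF that, of w] by (metis dual_order.trans not_le zero_le_power2 power2_eq_iff_nonneg
          antisym zero_eq_power2)
    then show ?thesis by (simp add: hopping_def onsite_def)
  qed
  have stationary: "sinh (2 * J i) * v i + sinh (2 * J (nxt i)) * v (nxt (nxt i)) =
      \<rho> * (cosh (2 * J i) + cosh (2 * J (nxt i))) * v (nxt i)" if "i < n" for i
  proof -
    define a where "a = \<rho> * (cosh (2 * J i) + cosh (2 * J (nxt i)))"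
    define b where "b = sinh (2 * J i) * v i + sinh (2 * J (nxt i)) * v (nxt (nxt i)) - a * v (nxt i)"
    \<comment> \<open>The varied vector may have a negative coordinate; \<open>le\<close> covers it
      nevertheless.\<close>
    have quad: "2 * x * b \<le> a * x\<^sup>2" for x
    proof -
      have "hopping J v + 2 * x * (sinh (2 * J i) * v i + sinh (2 * J (nxt i)) * v (nxt (nxt i)))
        \<le> \<rho> * (onsite J v + (cosh (2 * J i) + cosh (2 * J (nxt i))) * (2 * x * v (nxt i) + x\<^sup>2))"
        using le[of "v(nxt i := v (nxt i) + x)"]
        unfolding hopping_update[OF that] onsite_update[OF that] .
      then show ?thesis by (simp add: a_def b_def v1 \<rho>_def[symmetric] algebra_simps)
    qed
    have "b = 0"
    proof (rule ccontr)
      assume "b \<noteq> 0"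
      \<comment> \<open>With the test step \<open>y * b\<close> and \<open>y\<close> this small, the
        quadratic term cannot outweigh the linear one.\<close>
      define y where "y = 1 / (\<bar>a\<bar> + 1)"
      have y: "y > 0" "y * \<bar>a\<bar> \<le> 1" by (auto simp: y_def field_simps)
      have "2 * y * b\<^sup>2 \<le> a * y\<^sup>2 * b\<^sup>2"
        using quad[of "y * b"] by (simp add: power2_eq_square algebra_simps)
      then have "2 * y \<le> a * y\<^sup>2" using \<open>b \<noteq> 0\<close> by simp
      then have "2 \<le> a * y" using y(1) by (simp add: power2_eq_square)
      moreover have "a * y \<le> \<bar>a\<bar> * y" using y(1) by (intro mult_right_mono) auto
      ultimately show False using y(2) by (simp add: mult.commute)
    qed
    then show ?thesis by (simp add: a_def b_def)
  qed
  have "v i > 0" if "i < n" for i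
  proof (rule ccontr)
    assume "\<not> v i > 0"
    then have "v i = 0" using v0[of i] by simp
    \<comment> \<open>At a zero, the stationarity equation makes a sum of nonnegative neighbour
      terms vanish. Zeros therefore spread around the cycle, contradicting the
      normalization.\<close>
    have "v j = 0" if "j < n" for j
    proof (rule propagate_backwards[where P = "\<lambda>j. v j = 0", OF \<open>i < n\<close> \<open>v i = 0\<close> _ that])
      fix k assume k: "k < n" "v (nxt k) = 0"
      have "sinh (2 * J k) * v k \<ge> 0" "sinh (2 * J (nxt k)) * v (nxt (nxt k)) \<ge> 0"
        using J[of k] J[of "nxt k"] k v0 by auto
      moreover have "sinh (2 * J k) * v k + sinh (2 * J (nxt k)) * v (nxt (nxt k)) = 0"
        using stationary[OF k(1)] k(2) by simp
      ultimately have "sinh (2 * J k) * v k = 0" by linarith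
      then show "v k = 0" using J[of k] k(1) by auto
    qed
    then show False using v1 by (simp add: onsite_def)
  qed
  then have "perron_pair J \<rho> v"
    using stationary by (simp add: perron_pair_def)
  then show thesis using le that by blast
qed

section \<open>Estimates for a Perron pair\<close>

context
  fixes J v :: "nat \<Rightarrow> real" and \<rho> :: real
  assumes J: "\<And>i. i < n \<Longrightarrow> J i > 0" and perron: "perron_pair J \<rho> v"
begin

lemma perron_pos: "i < n \<Longrightarrow> v i > 0"
  and perron_eq: "i < n \<Longrightarrow> sinh (2 * J i) * v i + sinh (2 * J (nxt i)) * v (nxt (nxt i)) =
      \<rho> * (cosh (2 * J i) + cosh (2 * J (nxt i))) * v (nxt i)"
  using perron by (auto simp: perron_pair_def)

text \<open>Multiply the equation of each vertex by its coordinate of \<open>v\<close> and sum; each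
  edge is met once from either end.\<close>

lemma perron_quotient: "hopping J v = \<rho> * onsite J v"
proof -
  define s where "s i = sinh (2 * J i)" for i
  define c where "c i = cosh (2 * J i)" for i
  have "hopping J v = (\<Sum>i<n. s i * v i * v (nxt i)) + (\<Sum>i<n. s i * v i * v (nxt i))"
    unfolding hopping_def s_def by (simp add: sum.distrib[symmetric] algebra_simps)
  also have "\<dots> = (\<Sum>i<n. s i * v i * v (nxt i)) + (\<Sum>i<n. s (nxt i) * v (nxt i) * v (nxt (nxt i)))"
    by (simp only: sum_nxt[of "\<lambda>i. s i * v i * v (nxt i)"])
  also have "\<dots> = (\<Sum>i<n. (s i * v i + s (nxt i) * v (nxt (nxt i))) * v (nxt i))"
    unfolding sum.distrib[symmetric] by (rule sum.cong) (auto simp: algebra_simps)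
  also have "\<dots> = (\<Sum>i<n. \<rho> * (c i + c (nxt i)) * v (nxt i) * v (nxt i))"
    by (rule sum.cong) (auto simp: perron_eq s_def c_def)
  also have "\<dots> = \<rho> * ((\<Sum>i<n. c i * (v (nxt i))\<^sup>2) + (\<Sum>i<n. c (nxt i) * (v (nxt i))\<^sup>2))"
    unfolding sum.distrib[symmetric] sum_distrib_left
    by (rule sum.cong) (auto simp: algebra_simps power2_eq_square)
  also have "(\<Sum>i<n. c (nxt i) * (v (nxt i))\<^sup>2) = (\<Sum>i<n. c i * (v i)\<^sup>2)"
    by (rule sum_nxt)
  also have "\<rho> * ((\<Sum>i<n. c i * (v (nxt i))\<^sup>2) + (\<Sum>i<n. c i * (v i)\<^sup>2)) = \<rho> * onsite J v"
    unfolding onsite_def c_def sum.distrib[symmetric] by (simp add: algebra_simps)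
  finally show ?thesis .
qed

lemma onsite_pos: "onsite J' v > 0"
  unfolding onsite_def
proof (rule sum_pos)
  fix i assume "i \<in> {..<n}"
  then show "0 < cosh (2 * J' i) * ((v i)\<^sup>2 + (v (nxt i))\<^sup>2)"
    using perron_pos[of i] by (intro mult_pos_pos) (auto intro!: add_pos_nonneg)
qed (use vertices_nonempty in auto)

text \<open>The upper bound holds edge by edge, from \<open>sinh < cosh\<close> and
  \<open>2 x y \<le> x\<^sup>2 + y\<^sup>2\<close>.\<close>

lemma perron_value_bounds: "0 < \<rho>" "\<rho> < 1"
proof -
  have "0 < hopping J v"
    unfolding hopping_def
    by (rule sum_pos) (use vertices_nonempty perron_pos J in auto)
  then show "0 < \<rho>" using onsite_pos[of J] by (simp add: perron_quotient zero_less_mult_iff)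
  have "hopping J v < onsite J v"
    unfolding hopping_def onsite_def
  proof (rule sum_strict_mono)
    fix i assume "i \<in> {..<n}"
    then have pos: "v i > 0" "v (nxt i) > 0" "0 < sinh (2 * J i)" using perron_pos J by auto
    have "2 * sinh (2 * J i) * v i * v (nxt i) < cosh (2 * J i) * (2 * v i * v (nxt i))"
      using pos sinh_less_cosh_real[of "2 * J i"] by simp
    also have "\<dots> \<le> cosh (2 * J i) * ((v i)\<^sup>2 + (v (nxt i))\<^sup>2)"
      using sum_squares_bound[of "v i" "v (nxt i)"] by (intro mult_left_mono) auto
    finally show "2 * sinh (2 * J i) * v i * v (nxt i) < cosh (2 * J i) * ((v i)\<^sup>2 + (v (nxt i))\<^sup>2)" .
  qed (use vertices_nonempty in auto)
  then show "\<rho> < 1" using onsite_pos[of J] by (simp add: perron_quotient)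
qed

text \<open>
  The ratio \<open>u\<^sub>i\<close> of the flux through edge \<open>i\<close> to \<open>v\<^sub>i\<close> obeys a first-order recursion around the cycle.
  Where it is largest or smallest it cannot move outwards, which forces \<open>u\<^sub>i\<^sup>2 \<le> \<rho>\<^sup>2 c\<^sub>i\<^sup>2 - s\<^sub>i\<^sup>2 \<le> \<rho>\<^sup>2\<close>.
\<close>

lemma flux_bound:
  assumes "i < n"
  shows "\<bar>sinh (2 * J i) * v (nxt i) - \<rho> * cosh (2 * J i) * v i\<bar> \<le> \<rho> * v i"
proof -
  define s where "s i = sinh (2 * J i)" for i
  define c where "c i = cosh (2 * J i)" for i
  define u where "u i = (s i * v (nxt i) - \<rho> * c i * v i) / v i" for i
  note \<rho> = perron_value_bounds
  have s_pos: "s i > 0" if "i < n" for i using J[OF that] by (simp add: s_def)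
  have out: "s i * v (nxt i) = (u i + \<rho> * c i) * v i" if "i < n" for i
    using perron_pos[OF that] by (simp add: u_def field_simps)
  \<comment> \<open>The same edge seen from its other end, by the Perron equation at
    \<open>nxt i\<close>. Multiplying it with \<open>out\<close> gives the recursion
    \<open>prod\<close>.\<close>
  have inn: "s i * v i = (\<rho> * c i - u (nxt i)) * v (nxt i)" if "i < n" for i
    using out[of "nxt i"] perron_eq[OF that] by (simp add: s_def c_def algebra_simps)
  have sq: "x\<^sup>2 \<le> \<rho>\<^sup>2" if j: "j < n" and x: "(s j)\<^sup>2 \<le> (x + \<rho> * c j) * (\<rho> * c j - x)" for j x
  proof -
    have "(c j)\<^sup>2 = (s j)\<^sup>2 + 1" by (simp add: s_def c_def cosh_square_eq)
    then have "x\<^sup>2 \<le> \<rho>\<^sup>2 * ((s j)\<^sup>2 + 1) - (s j)\<^sup>2"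
      using x by (metis (no_types, lifting) add.commute diff_le_eq le_diff_eq power2_eq_square power_mult_distrib square_diff_square_factored)
    also have "\<dots> \<le> \<rho>\<^sup>2"
      using mult_right_mono[of "\<rho>\<^sup>2" 1 "(s j)\<^sup>2"] \<rho> by (simp add: algebra_simps power_le_one)
    finally show ?thesis .
  qed
  have prod: "(s j)\<^sup>2 = (u j + \<rho> * c j) * (\<rho> * c j - u (nxt j))"
    "u j + \<rho> * c j > 0" "\<rho> * c j - u (nxt j) > 0" if "j < n" for j
  proof -
    have pos: "v j > 0" "v (nxt j) > 0" "s j > 0" using perron_pos that s_pos by auto
    have "(s j * v (nxt j)) * (s j * v j) =
      ((u j + \<rho> * c j) * v j) * ((\<rho> * c j - u (nxt j)) * v (nxt j))"
      using out[OF that] inn[OF that] by simp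
    then have "(s j)\<^sup>2 * (v j * v (nxt j)) =
      (u j + \<rho> * c j) * (\<rho> * c j - u (nxt j)) * (v j * v (nxt j))"
      by (simp add: power2_eq_square mult_ac)
    then show "(s j)\<^sup>2 = (u j + \<rho> * c j) * (\<rho> * c j - u (nxt j))" using pos by simp
    show "u j + \<rho> * c j > 0"
      using out[OF that] pos by (metis mult_pos_pos zero_less_mult_pos2)
    show "\<rho> * c j - u (nxt j) > 0"
      using inn[OF that] pos by (metis mult_pos_pos zero_less_mult_pos2)
  qed
  have fin: "finite (u ` {..<n})" "u ` {..<n} \<noteq> {}" using vertices_nonempty by auto
  obtain m where m: "m < n" "\<And>k. k < n \<Longrightarrow> u k \<le> u m"
    using Max_in[OF fin] Max_ge[OF fin(1)] by (metis (no_types, lifting) imageE imageI lessThan_iff)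
  obtain l where l: "l < n" "\<And>k. k < n \<Longrightarrow> u l \<le> u k"
    using Min_in[OF fin] Min_le[OF fin(1)] by (metis (no_types, lifting) imageE imageI lessThan_iff)
  have "(u m)\<^sup>2 \<le> \<rho>\<^sup>2"
  proof (rule sq[of "prv m"])
    \<comment> \<open>In \<open>prod\<close> at \<open>prv m\<close>, the outgoing value is replaced
      by the larger \<open>u m\<close>; at the minimum \<open>l\<close> the incoming value is
      replaced instead.\<close>
    have "u (prv m) \<le> u m" by (rule m) simp
    then show "(s (prv m))\<^sup>2 \<le> (u m + \<rho> * c (prv m)) * (\<rho> * c (prv m) - u m)"
      using prod[of "prv m"] m(1) by (simp add: mult_right_mono)
  qed simp
  then have "u m \<le> \<rho>" using \<rho> by (simp add: abs_le_square_iff[symmetric])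
  moreover have "(u l)\<^sup>2 \<le> \<rho>\<^sup>2"
  proof (rule sq[OF l(1)])
    have "u l \<le> u (nxt l)" by (rule l) simp
    then show "(s l)\<^sup>2 \<le> (u l + \<rho> * c l) * (\<rho> * c l - u l)"
      using prod[OF l(1)] by (simp add: mult_left_mono)
  qed
  then have "- \<rho> \<le> u l" using \<rho> by (simp add: abs_le_square_iff[symmetric])
  ultimately have "\<bar>u i\<bar> \<le> \<rho>" using m(2)[OF assms] l(2)[OF assms] by simp
  then show ?thesis
    using perron_pos[OF assms] by (simp add: u_def s_def c_def abs_divide field_simps)
qed

text \<open>The flux bounds say that \<open>v (nxt i) / v i\<close> lies between
  \<open>tanh (J i)\<close> and its reciprocal. A number plus its inverse is largest at the ends of
  such an interval, where it equals \<open>2 * cosh (2 * J i) / sinh (2 * J i)\<close>.\<close>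

lemma perron_edge_bound:
  assumes "i < n"
  shows "sinh (2 * J i) * ((v i)\<^sup>2 + (v (nxt i))\<^sup>2) \<le> cosh (2 * J i) * (2 * v i * v (nxt i))"
proof -
  define s where "s = sinh (2 * J i)"
  define c where "c = cosh (2 * J i)"
  define x where "x = v i"
  define y where "y = v (nxt i)"
  have pos: "x > 0" "y > 0" using perron_pos assms by (auto simp: x_def y_def)
  have c1: "c \<ge> 1" by (simp add: c_def cosh_real_ge_1)
  note \<rho> = perron_value_bounds
  have \<rho>c: "\<rho> * c + \<rho> \<le> 1 + c"
    using \<rho> c1 mult_right_mono[of \<rho> 1 c] by linarith
  have "s * y \<le> (\<rho> * c + \<rho>) * x"
    using flux_bound[OF assms] by (simp add: s_def c_def x_def y_def algebra_simps)
  also have "\<dots> \<le> (1 + c) * x" using \<rho>c pos by simp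
  finally have 1: "s * y \<le> (1 + c) * x" .
  \<comment> \<open>The lower flux bound at \<open>nxt i\<close>, carried back to edge
    \<open>i\<close> by the Perron equation.\<close>
  have "s * x \<le> (\<rho> * c + \<rho>) * y"
    using flux_bound[of "nxt i"] perron_eq[OF assms]
    by (simp add: s_def c_def x_def y_def algebra_simps)
  also have "\<dots> \<le> (1 + c) * y" using \<rho>c pos by simp
  finally have 2: "s * x \<le> (1 + c) * y" .
  have cs: "s\<^sup>2 = c\<^sup>2 - 1" by (simp add: s_def c_def cosh_square_eq)
  have "0 \<le> ((1 + c) * x - s * y) * ((1 + c) * y - s * x)"
    using 1 2 by simp
  also have "\<dots> = ((1 + c)\<^sup>2 + s\<^sup>2) * (x * y) - (1 + c) * (s * (x\<^sup>2 + y\<^sup>2))"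
    by (simp add: power2_eq_square algebra_simps)
  also have "\<dots> = (1 + c) * (c * (2 * x * y) - s * (x\<^sup>2 + y\<^sup>2))"
    unfolding cs by (simp add: power2_eq_square algebra_simps)
  finally have "0 \<le> c * (2 * x * y) - s * (x\<^sup>2 + y\<^sup>2)"
    using c1 by (simp add: zero_le_mult_iff)
  then show ?thesis by (simp add: s_def c_def x_def y_def)
qed

text \<open>\<open>v\<close> is the test vector for the shifted couplings. In the form
  \<open>H / (D - H)\<close>, the numerator gains \<open>exp (2 * h)\<close> and the denominator
  grows by at most \<open>cosh (2 * h)\<close>.\<close>

lemma perron_shift:
  assumes h: "h \<ge> 0" and \<rho>': "\<rho>' < 1"
    and opt: "\<And>w. hopping (\<lambda>i. J i + h) w \<le> \<rho>' * onsite (\<lambda>i. J i + h) w"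
  shows "exp (2 * h) * (\<rho> / (1 - \<rho>)) \<le> cosh (2 * h) * (\<rho>' / (1 - \<rho>'))"
proof -
  let ?J = "\<lambda>i. J i + h"
  define H where "H = hopping J v"
  define H' where "H' = hopping ?J v"
  define E where "E = onsite J v - hopping J v"
  define E' where "E' = onsite ?J v - hopping ?J v"
  note \<rho> = perron_value_bounds
  have D: "onsite J v > 0" "onsite ?J v > 0" by (rule onsite_pos)+
  have "E = (1 - \<rho>) * onsite J v" by (simp add: E_def perron_quotient algebra_simps)
  then have E: "E > 0" "H / E = \<rho> / (1 - \<rho>)"
    using D \<rho> by (auto simp: H_def perron_quotient)
  have "\<rho>' * onsite ?J v < onsite ?J v" using \<rho>' D by simp
  then have E': "E' > 0" using opt[of v] by (simp add: E'_def)
  have "H' * (1 - \<rho>') \<le> \<rho>' * E'"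
    using opt[of v] by (simp add: E'_def H'_def algebra_simps)
  then have quot: "H' / E' \<le> \<rho>' / (1 - \<rho>')"
    using E' \<rho>' by (simp add: field_simps)
  have "E' \<le> cosh (2 * h) * E"
  proof -
    have "E' = (\<Sum>i<n. cosh (2 * ?J i) * ((v i)\<^sup>2 + (v (nxt i))\<^sup>2) - sinh (2 * ?J i) * (2 * v i * v (nxt i)))"
      unfolding E'_def onsite_def hopping_def sum_subtractf[symmetric]
      by (rule sum.cong) (auto simp: mult_ac)
    also have "\<dots> \<le> (\<Sum>i<n. cosh (2 * h) * (cosh (2 * J i) * ((v i)\<^sup>2 + (v (nxt i))\<^sup>2) -
        sinh (2 * J i) * (2 * v i * v (nxt i))))"
    proof (rule sum_mono)
      fix i assume "i \<in> {..<n}"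
      \<comment> \<open>By the addition formulas, the shifted edge term is
        \<open>cosh (2 * h)\<close> times the old one plus \<open>sinh (2 * h)\<close> times a
        quantity that the edge bound makes nonpositive.\<close>
      then have "sinh (2 * h) * (sinh (2 * J i) * ((v i)\<^sup>2 + (v (nxt i))\<^sup>2))
        \<le> sinh (2 * h) * (cosh (2 * J i) * (2 * v i * v (nxt i)))"
        using h by (intro mult_left_mono perron_edge_bound) auto
      then show "cosh (2 * ?J i) * ((v i)\<^sup>2 + (v (nxt i))\<^sup>2) - sinh (2 * ?J i) * (2 * v i * v (nxt i))
        \<le> cosh (2 * h) * (cosh (2 * J i) * ((v i)\<^sup>2 + (v (nxt i))\<^sup>2) - sinh (2 * J i) * (2 * v i * v (nxt i)))"
        by (simp add: distrib_left[of 2] cosh_add sinh_add) (simp add: algebra_simps)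
    qed
    also have "\<dots> = cosh (2 * h) * E"
      unfolding E_def onsite_def hopping_def sum_subtractf[symmetric] sum_distrib_left
      by (rule sum.cong) (auto simp: algebra_simps)
    finally show ?thesis .
  qed
  moreover have H': "exp (2 * h) * H \<le> H'"
    unfolding H_def H'_def hopping_def sum_distrib_left
  proof (rule sum_mono)
    fix i assume "i \<in> {..<n}"
    then have pos: "v i > 0" "v (nxt i) > 0" using perron_pos by auto
    have "exp (2 * h) * sinh (2 * J i) = (cosh (2 * h) + sinh (2 * h)) * sinh (2 * J i)"
      by (simp add: cosh_plus_sinh)
    also have "\<dots> \<le> sinh (2 * ?J i)"
      using h mult_left_mono[OF sinh_le_cosh_real[of "2 * J i"], of "sinh (2 * h)"]
      by (simp add: distrib_left[of 2] sinh_add) (simp add: algebra_simps)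
    finally show "exp (2 * h) * (2 * sinh (2 * J i) * v i * v (nxt i)) \<le> 2 * sinh (2 * ?J i) * v i * v (nxt i)"
      using pos mult_right_mono[of "exp (2 * h) * sinh (2 * J i)" "sinh (2 * ?J i)" "2 * v i * v (nxt i)"]
      by (simp add: mult_ac)
  qed
  moreover have "0 \<le> exp (2 * h) * H"
    using \<rho> D by (simp add: H_def perron_quotient)
  then have "0 \<le> H'" using H' by linarith
  ultimately have "(exp (2 * h) * H) / (cosh (2 * h) * E) \<le> H' / E'"
    using E' E by (intro frac_le) auto
  with quot have "(exp (2 * h) * H) / (cosh (2 * h) * E) \<le> \<rho>' / (1 - \<rho>')" by simp
  then have "cosh (2 * h) * ((exp (2 * h) * H) / (cosh (2 * h) * E)) \<le> cosh (2 * h) * (\<rho>' / (1 - \<rho>'))"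
    by (intro mult_left_mono) auto
  moreover have "cosh (2 * h) * ((exp (2 * h) * H) / (cosh (2 * h) * E)) = exp (2 * h) * (H / E)"
    using cosh_real_pos[of "2 * h"] by simp
  ultimately show ?thesis unfolding E(2) by simp
qed

end

subsection \<open>The relaxation time\<close>

text \<open>For a spin of absolute value 1, \<open>cosh\<close> ignores its sign and
  \<open>sinh\<close> lets it out as a factor. The conditional mean thus becomes linear in the
  neighbours.\<close>

lemma tanh_local_field:
  assumes \<sigma>: "\<sigma> \<in> configs n" and i: "i < n"
  shows "(cosh (2 * J (prv i)) + cosh (2 * J i)) * tanh (local_field J \<sigma> i) =
    sinh (2 * J (prv i)) * \<sigma> (prv i) + sinh (2 * J i) * \<sigma> (nxt i)"
  using tanh_add_mult_cosh[of "J (prv i) * \<sigma> (prv i)" "J i * \<sigma> (nxt i)"]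
    configs_spin[OF \<sigma> prv_less, of i] configs_spin[OF \<sigma> nxt_less, of i]
  by (auto simp: local_field_def mult.commute)

text \<open>The \<open>cosh\<close> factor in the weight of vertex \<open>i\<close> clears the
  denominator of its conditional mean.\<close>

definition linear_eigenfunction :: "(nat \<Rightarrow> real) \<Rightarrow> (nat \<Rightarrow> real) \<Rightarrow> (nat \<Rightarrow> real) \<Rightarrow> real" where
  "linear_eigenfunction J v \<sigma> = (\<Sum>i<n. (cosh (2 * J (prv i)) + cosh (2 * J i)) * v i * \<sigma> i)"

lemma linear_eigenfunction_fun_upd:
  assumes "i < n"
  shows "linear_eigenfunction J v (\<sigma>(i := x)) =
    linear_eigenfunction J v \<sigma> + (cosh (2 * J (prv i)) + cosh (2 * J i)) * v i * (x - \<sigma> i)"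
proof -
  have "linear_eigenfunction J v (\<sigma>(i := x)) - linear_eigenfunction J v \<sigma> =
    (\<Sum>j<n. if j = i then (cosh (2 * J (prv i)) + cosh (2 * J i)) * v i * (x - \<sigma> i) else 0)"
    unfolding linear_eigenfunction_def sum_subtractf[symmetric]
    by (rule sum.cong) (auto simp: algebra_simps)
  then show ?thesis using assms by simp
qed

text \<open>On a linear function, redrawing a spin replaces it by its conditional mean. Regrouping
  the means by the neighbour they involve produces the Perron equations.\<close>

lemma heat_bath_linear_eigenfunction:
  assumes \<sigma>: "\<sigma> \<in> configs n" and perron: "perron_pair J \<rho> v"
  shows "heat_bath J (linear_eigenfunction J v) \<sigma> = (1 - (1 - \<rho>) / n) * linear_eigenfunction J v \<sigma>"
proof -
  let ?f = "linear_eigenfunction J v"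
  define s where "s i = sinh (2 * J i)" for i
  define d where "d i = cosh (2 * J (prv i)) + cosh (2 * J i)" for i
  define T where "T i = tanh (local_field J \<sigma> i)" for i
  have upd: "?f (\<sigma>(i := x)) = ?f \<sigma> + d i * v i * (x - \<sigma> i)" if "i < n" for i x
    unfolding d_def by (rule linear_eigenfunction_fun_upd[OF that])
  have "(\<Sum>i<n. d i * v i * T i) = (\<Sum>i<n. v i * (s (prv i) * \<sigma> (prv i) + s i * \<sigma> (nxt i)))"
    using tanh_local_field[OF \<sigma>, of _ J]
    by (intro sum.cong) (auto simp: d_def T_def s_def mult.assoc mult.left_commute[of _ "v _"])
  also have "\<dots> = (\<Sum>i<n. v i * s (prv i) * \<sigma> (prv i)) + (\<Sum>i<n. s i * v i * \<sigma> (nxt i))"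
    by (simp add: sum.distrib[symmetric] algebra_simps)
  also have "(\<Sum>i<n. v i * s (prv i) * \<sigma> (prv i)) = (\<Sum>i<n. v (nxt i) * s i * \<sigma> i)"
    by (subst sum_nxt[symmetric]) (rule sum.cong, auto)
  also have "\<dots> = (\<Sum>i<n. v (nxt (nxt i)) * s (nxt i) * \<sigma> (nxt i))"
    by (rule sum_nxt[symmetric])
  also have "\<dots> + (\<Sum>i<n. s i * v i * \<sigma> (nxt i)) =
    (\<Sum>i<n. (s i * v i + s (nxt i) * v (nxt (nxt i))) * \<sigma> (nxt i))"
    unfolding sum.distrib[symmetric] by (rule sum.cong) (auto simp: algebra_simps)
  also have "\<dots> = (\<Sum>i<n. \<rho> * (d (nxt i) * v (nxt i) * \<sigma> (nxt i)))"
    using perron by (intro sum.cong) (auto simp: perron_pair_def s_def d_def)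
  also have "\<dots> = \<rho> * ?f \<sigma>"
    unfolding sum_nxt[of "\<lambda>i. \<rho> * (d i * v i * \<sigma> i)"]
    by (simp add: linear_eigenfunction_def d_def sum_distrib_left)
  finally have mean: "(\<Sum>i<n. d i * v i * T i) = \<rho> * ?f \<sigma>" .
  have "n * heat_bath J ?f \<sigma> = (\<Sum>i<n. ?f \<sigma> + d i * v i * T i - d i * v i * \<sigma> i)"
    unfolding heat_bath_def T_def[symmetric] using n_ge_3
    by (auto simp: upd field_simps intro!: sum.cong)
  also have "\<dots> = n * ?f \<sigma> + \<rho> * ?f \<sigma> - ?f \<sigma>"
    unfolding sum_subtractf sum.distrib mean by (simp add: linear_eigenfunction_def d_def)
  finally show ?thesis using n_ge_3 by (simp add: field_simps)
qed

lemma mu2_eq: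
  assumes J: "\<And>i. i < n \<Longrightarrow> J i > 0" and perron: "perron_pair J \<rho> v"
  shows "mu2 n J = 1 - (1 - \<rho>) / n"
proof -
  let ?f = "linear_eigenfunction J v"
  define m :: nat where "m = 2 ^ n - 1"
  have m: "Suc m = 2 ^ n" by (simp add: m_def)
  have le_m: "k \<le> m \<longleftrightarrow> k < 2 ^ n" for k using m by auto
  have conf: "config_of n k \<in> configs n" if "k \<le> m" for k
    using that config_of_in_configs by (simp add: le_m)
  have apply_mat: "(\<Sum>l\<le>m. glauber_mat n J $$ (k, l) * g (config_of n l)) = heat_bath J g (config_of n k)"
    if k: "k \<le> m" for k g
  proof -
    have "(\<Sum>l\<le>m. glauber_mat n J $$ (k, l) * g (config_of n l)) =
      (\<Sum>l\<in>{..<2 ^ n}. glauber n J (config_of n k) (config_of n l) * g (config_of n l))"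
      using k by (intro sum.cong) (auto simp: le_m glauber_mat_def)
    also have "\<dots> = (\<Sum>\<tau>\<in>configs n. glauber n J (config_of n k) \<tau> * g \<tau>)"
      by (rule sum.reindex_bij_betw[OF bij_betw_config_of])
    finally show ?thesis by (simp add: sum_glauber_heat_bath[OF conf[OF k]])
  qed
  have f_incr: "?f (\<sigma>(i := -1)) < ?f (\<sigma>(i := 1))" if "i < n" for \<sigma> i
  proof -
    have "(cosh (2 * J (prv i)) + cosh (2 * J i)) * v i > 0"
      using perron that by (intro mult_pos_pos add_pos_pos) (auto simp: perron_pair_def)
    then show ?thesis
      unfolding linear_eigenfunction_fun_upd[OF that] by (simp add: mult_strict_left_mono)
  qed
  have "rev (sorted_list_of_multiset (proots (char_poly (glauber_mat n J)))) ! 1 = 1 - (1 - \<rho>) / n"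
  proof (rule second_eigenvalue_stochastic[where m = m])
    show "glauber_mat n J \<in> carrier_mat (Suc m) (Suc m)"
      by (simp add: glauber_mat_def m)
    show "(\<Sum>l\<le>m. glauber_mat n J $$ (k, l)) = 1" if "k \<le> m" for k
      using apply_mat[OF that, of "\<lambda>_. 1"] by (simp add: heat_bath_const)
    show "1 - (1 - \<rho>) / n < 1"
      using perron_value_bounds(2)[OF J perron] n_ge_3 by simp
    show "(\<Sum>l\<le>m. glauber_mat n J $$ (k, l) * ?f (config_of n l)) =
      (1 - (1 - \<rho>) / n) * ?f (config_of n k)" if "k \<le> m" for k
      unfolding apply_mat[OF that] by (rule heat_bath_linear_eigenfunction[OF conf[OF that] perron])
    have "?f (config_of n 0) \<noteq> ?f (config_of n 1)"
    proof -
      \<comment> \<open>Numbers 0 and 1 differ only in the spin at vertex 0, where \<open>?f\<close>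
        is strictly increasing, so \<open>?f\<close> cannot vanish at both.\<close>
      have "config_of n 1 = (config_of n 0)(0 := 1)" "config_of n 0 = (config_of n 0)(0 := -1)"
        using n_ge_3 by (auto simp: config_of_def fun_eq_iff bit_Suc_0_iff)
      then show ?thesis using f_incr[of 0 "config_of n 0"] n_ge_3 by simp
    qed
    moreover have "1 \<le> m" using n_ge_3 one_less_power[of "2::nat" n] by (simp add: le_m)
    ultimately show "\<exists>k\<le>m. ?f (config_of n k) \<noteq> 0" by (metis le0)
  next
    fix \<mu> c :: real and g :: "nat \<Rightarrow> real"
    assume g: "\<And>k. k \<le> m \<Longrightarrow> (\<Sum>l\<le>m. glauber_mat n J $$ (k, l) * g l) = \<mu> * g k + c"
      and "\<exists>k\<le>m. g k \<noteq> g 0"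
    then obtain k where k: "k \<le> m" "g k \<noteq> g 0" by blast
    define num where "num = inv_into {..<2 ^ n} (config_of n)"
    have num: "num (config_of n l) = l" if "l \<le> m" for l
      using that bij_betw_config_of[of n] by (auto simp: num_def le_m bij_betw_def)
    show "\<mu> \<le> 1 - (1 - \<rho>) / n"
    proof (rule eigenvalue_le_of_increasing_eigenfunction[where f = ?f and g = "g \<circ> num"])
      show "heat_bath J ?f \<sigma> = (1 - (1 - \<rho>) / n) * ?f \<sigma>" if "\<sigma> \<in> configs n" for \<sigma>
        by (rule heat_bath_linear_eigenfunction[OF that perron])
      show "heat_bath J (g \<circ> num) \<sigma> = \<mu> * (g \<circ> num) \<sigma> + c" if \<sigma>: "\<sigma> \<in> configs n" for \<sigma>
      proof -
        obtain j where j: "j \<le> m" "\<sigma> = config_of n j"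
          using \<sigma> bij_betw_imp_surj_on[OF bij_betw_config_of, of n] unfolding le_m by blast
        then show ?thesis
          using apply_mat[of j "g \<circ> num"] g[of j] by (simp add: num)
      qed
      show "config_of n k \<in> configs n" "config_of n 0 \<in> configs n" using conf k by auto
      show "(g \<circ> num) (config_of n k) \<noteq> (g \<circ> num) (config_of n 0)" using k by (simp add: num)
    qed (use J f_incr in \<open>auto simp: less_imp_le\<close>)
  qed
  then show ?thesis by (simp add: mu2_def glauber_eigenvalues_def)
qed

lemma tau_star_eq:
  assumes J: "\<And>i. i < n \<Longrightarrow> J i > 0" and perron: "perron_pair J \<rho> v"
  shows "tau_star n J = \<rho> / (1 - \<rho>)"
  using perron_value_bounds[OF J perron] n_ge_3
  by (simp add: tau_star_def relaxation_time_def mu2_eq[OF J perron] field_simps)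

text \<open>Maximality enters at the shifted couplings, the Perron equations at the original
  ones.\<close>

lemma tau_star_shift:
  assumes J: "\<And>i. i < n \<Longrightarrow> J i > 0" and h: "h \<ge> 0"
  shows "exp (2 * h) * tau_star n J \<le> cosh (2 * h) * tau_star n (\<lambda>i. J i + h)"
proof -
  have J': "J i + h > 0" if "i < n" for i using J[OF that] h by simp
  obtain \<rho> v where p: "perron_pair J \<rho> v" using perron_pair_exists[OF J] .
  obtain \<rho>' v' where p': "perron_pair (\<lambda>i. J i + h) \<rho>' v'"
    and opt: "\<And>w. hopping (\<lambda>i. J i + h) w \<le> \<rho>' * onsite (\<lambda>i. J i + h) w"
    using perron_pair_exists[of "\<lambda>i. J i + h", OF J'] by blast
  have "\<rho>' < 1" by (rule perron_value_bounds[OF _ p']) (rule J')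
  then have "exp (2 * h) * (\<rho> / (1 - \<rho>)) \<le> cosh (2 * h) * (\<rho>' / (1 - \<rho>'))"
    by (intro perron_shift[OF _ p h _ opt] J)
  moreover have "tau_star n J = \<rho> / (1 - \<rho>)" by (rule tau_star_eq[OF _ p]) (rule J)
  moreover have "tau_star n (\<lambda>i. J i + h) = \<rho>' / (1 - \<rho>')" by (rule tau_star_eq[OF _ p']) (rule J')
  ultimately show ?thesis by simp
qed

end

section \<open>Removing the loss factor by subdividing the shift\<close>

theorem theorem11:
  fixes n :: nat and J :: "nat \<Rightarrow> real" and t :: real
  assumes "n \<ge> 3"
    and "\<And>i. i < n \<Longrightarrow> J i > 0"
    and "t \<ge> 0"
  shows "tau_star n (\<lambda>i. J i + t) \<ge> exp (2 * t) * tau_star n J"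
proof -
  interpret cycle n by standard (rule assms)
  have steps: "exp (2 * h * k) * tau_star n J \<le> cosh (2 * h) ^ k * tau_star n (\<lambda>i. J i + h * k)"
    if "h \<ge> 0" for h :: real and k :: nat
  proof (induction k)
    case (Suc k)
    have "exp (2 * h * Suc k) * tau_star n J = exp (2 * h) * (exp (2 * h * k) * tau_star n J)"
      by (simp add: exp_add[symmetric] algebra_simps)
    also have "\<dots> \<le> exp (2 * h) * (cosh (2 * h) ^ k * tau_star n (\<lambda>i. J i + h * k))"
      using Suc.IH by simp
    also have "\<dots> = cosh (2 * h) ^ k * (exp (2 * h) * tau_star n (\<lambda>i. J i + h * k))"
      by simp
    also have "\<dots> \<le> cosh (2 * h) ^ k * (cosh (2 * h) * tau_star n (\<lambda>i. J i + h * k + h))"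
      using assms(2) that by (intro mult_left_mono tau_star_shift) (auto intro: add_pos_nonneg)
    finally show ?case by (simp add: algebra_simps)
  qed simp
  obtain \<rho> v where p: "perron_pair (\<lambda>i. J i + t) \<rho> v"
    using perron_pair_exists[of "\<lambda>i. J i + t"] assms(2,3) by (metis add_pos_nonneg)
  have "tau_star n (\<lambda>i. J i + t) = \<rho> / (1 - \<rho>)" "0 < \<rho>" "\<rho> < 1"
    using assms(2,3) by (intro tau_star_eq[OF _ p] perron_value_bounds[OF _ p]; simp add: add_pos_nonneg)+
  \<comment> \<open>Needed to multiply the bound on the loss by \<open>tau_star\<close>.\<close>
  then have nonneg: "tau_star n (\<lambda>i. J i + t) \<ge> 0" by simp
  have "exp (2 * t) * tau_star n J \<le> exp (2 * t\<^sup>2 / real (Suc N)) * tau_star n (\<lambda>i. J i + t)" for N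
  proof -
    \<comment> \<open>\<open>Suc N\<close> equal steps, so that the divisor is nonzero; the
      exponents \<open>(2 * h)\<^sup>2 / 2\<close> add up to
      \<open>2 * t\<^sup>2 / real (Suc N)\<close>, which tends to 0.\<close>
    define h where "h = t / real (Suc N)"
    have h: "h \<ge> 0" "h * real (Suc N) = t" using assms(3) by (auto simp: h_def)
    have "cosh (2 * h) ^ Suc N \<le> exp ((2 * h)\<^sup>2 / 2) ^ Suc N"
      by (intro power_mono cosh_le_exp_half_square) (use h(1) in \<open>auto simp: less_imp_le\<close>)
    also have "\<dots> = exp (2 * t\<^sup>2 / real (Suc N))"
      unfolding exp_of_nat_mult[symmetric]
      by (simp add: h_def power2_eq_square del: of_nat_Suc)
    finally have "cosh (2 * h) ^ Suc N * tau_star n (\<lambda>i. J i + t)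
      \<le> exp (2 * t\<^sup>2 / real (Suc N)) * tau_star n (\<lambda>i. J i + t)"
      using nonneg by (rule mult_right_mono)
    moreover have "exp (2 * t) * tau_star n J \<le> cosh (2 * h) ^ Suc N * tau_star n (\<lambda>i. J i + t)"
      using steps[OF h(1), of "Suc N"] unfolding h(2) mult.assoc[of 2 h] .
    ultimately show ?thesis by linarith
  qed
  moreover have "(\<lambda>N. exp (2 * t\<^sup>2 / real (Suc N)) * tau_star n (\<lambda>i. J i + t))
    \<longlonglongrightarrow> exp 0 * tau_star n (\<lambda>i. J i + t)"
    by (intro tendsto_intros LIMSEQ_Suc[OF lim_const_over_n])
  ultimately show ?thesis
    by (intro LIMSEQ_le_const) auto
qed

end
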